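(* Let $p$ be a power of $2$, let $q$ be a power of $p$, let $R(x)=\sum_{i=0}^e a_ix^{p^i}\in\mathbb{F}_q[x]$ with $e\ge 1$, $a_e\ne 0$, and let $A\subset H_R$ be a maximal abelian subgroup with $A\subset\mathbb{F}_q^2$. Let $\psi$ be a nontrivial character of $\mathbb{F}_p$ and let $\xi\in A_\psi^\vee$, with associated $\xi_{W_2}$, $\alpha$, $\beta_\xi$ as in the context. Then there is an isomorphism of $\overline{\mathbb{Q}}_\ell$-sheaves on $\mathbb{A}^1_{\mathbb{F}_q}$ (with coordinate $s$): $$\mathcal{Q}_\xi\simeq\mathcal{L}_{\xi_{W_2}}(s,\ \alpha s^2+\beta_\xi s).$$
   Context: Basics. $\mathbb{F}$ is an algebraic closure of $\mathbb{F}_q$; finite fields are viewed inside $\mathbb{F}$; $\ell$ is an odd prime; for $u\in\mathbb{F}$, $u^{p^{-i}}$ denotes the unique root. $G^\vee=\mathrm{Hom}(G,\overline{\mathbb{Q}}_\ell^\times)$ for a finite abelian group $G$. $\mathscr{A}$ is the set of $\mathbb{F}_p$-linearized polynomials $\sum_i c_ix^{p^i}\in\mathbb{F}_q[x]$; $\mathrm{Ker}\,g=\{x\in\mathbb{F}: g(x)=0\}$ for $g\in\mathscr{A}$. $C_R$ is the affine curve $y^p-y=xR(x)$ over $\mathbb{F}_q$. Heisenberg group. Put $E_R(x)=R(x)^{p^e}+\sum_{i=0}^e(a_ix)^{p^{e-i}}$, $f_R(x,y)=-\sum_{i=0}^{e-1}\bigl(\sum_{j=0}^{e-i-1}(a_ix^{p^i}y)^{p^j}+(xR(y))^{p^i}\bigr)$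 and $V_R=\mathrm{Ker}\,E_R$. $H_R=\{(a,b)\in V_R\times\mathbb{F}: b^p-b=aR(a)\}$ is a group under $(a,b)\cdot(a',b')=(a+a',b+b'+f_R(a,a'))$, with center $\{0\}\times\mathbb{F}_p\simeq\mathbb{F}_p$. It acts on $C_{R,\mathbb{F}}$ on the right by $(x,y)\cdot(a,b)=(x+a,y+b+f_R(x,a))$. Let $\pi:H_R\to V_R$, $(a,b)\mapsto a$. Choices attached to $A$. $\overline{A}=\pi(A)\subset\mathbb{F}_q$ is an $e$-dimensional $\mathbb{F}_p$-subspace and $A=\pi^{-1}(\overline{A})$. Put $\overline{U}=\{a\in\overline{A}: f_R(a,a)=0\}$, an $\mathbb{F}_p$-subspace of dimension $e-1$. Fix (such data exist) a separable $f_{\overline{U}}\in\mathscr{A}$, $s_0\in\mathbb{F}_q$ with $S(x)=x^p+s_0x$, and $\Delta\in\mathbb{F}_q[x]$ with $\Delta(0)=0$, such that $\overline{U}=\mathrm{Ker}\,f_{\overline{U}}$, $\overline{A}=\mathrm{Ker}(f_{\overline{U}}^p+f_{\overline{U}})$ and $\Delta(x)^p+\Delta(x)=xR(x)+f_{\overline{U}}(x)S(f_{\overline{U}}(x))$. Put $F_A=f_{\overline{U}}^p+f_{\overline{U}}$. Fix $\alpha\in\mathbb{F}_q$ with $\alpha^{p^{-1}}+\alpha=s_0+1$ (it exists), and an $\mathbb{F}_p$-linear map $r:\overline{A}\to\overline{U}$ restricting to the identity on $\overline{U}$. Witt vectors. $W_2$ is the ring scheme of length-$2$ Witt vectors over $\mathbb{F}_2$: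 $(a,b)+(c,d)=(a+c,b+d+ac)$, $(a,b)\cdot(c,d)=(ac,bc^2+a^2d)$. Characters. The map $\varphi:A\to W_2(\mathbb{F}_p)\times\overline{U}$, $(a,b)\mapsto\bigl((f_{\overline{U}}(a),\,b+\Delta(a)+\alpha^{p^{-1}}f_{\overline{U}}(a)^2),\,r(a)\bigr)$, is an isomorphism of groups. $A_\psi^\vee$ is the set of $\xi\in A^\vee$ with $\xi(0,c)=\psi(c)$ for $c\in\mathbb{F}_p$. Write $\xi=(\xi_{W_2}\boxtimes\xi_{\overline{U}})\circ\varphi$ with $\xi_{W_2}\in W_2(\mathbb{F}_p)^\vee$, $\xi_{\overline{U}}\in\overline{U}^\vee$. There is a unique $a(x)\in\mathscr{A}$ with $x^q+x=a(F_A(x))=F_A(a(x))$; it induces a surjection $\mathbb{F}_q\to\overline{A}$. $\beta_\xi\in\mathbb{F}_q$ is the unique element with $\xi_{\overline{U}}(r(a(x)))=\psi(\mathrm{Tr}_{\mathbb{F}_q/\mathbb{F}_p}(\beta_\xi x))$ for all $x\in\mathbb{F}_q$. Sheaves. For a finite étale Galois covering $Y\to X$ with abelian group $G$ and $\chi\in G^\vee$, the associated smooth rank-one sheaf is taken with Deligne's convention: over a point $x\in X(\mathbb{F}_{q^m})$ with geometric point $P$ of $Y$ above it such that the $q^m$-power Frobenius sends $P$ to $P\cdot g$, $g\in G$, the geometric Frobenius acts on the stalk by $\chi(g)$. $\mathcal{Q}_\xi$ is the sheaf on $\mathbb{A}^1_{\mathbb{F}_q}$ associated with the $A$-covering $C_R\to\mathbb{A}^1_{\mathbb{F}_q}$,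 $(x,y)\mapsto F_A(x)$, and $\xi$. For $\chi\in W_2(\mathbb{F}_p)^\vee$, $\mathcal{L}_\chi(z,w)$ is the sheaf on $W_{2,\mathbb{F}_p}=\mathrm{Spec}\,\mathbb{F}_p[z,w]$ associated with the Lang torsor $L_p:W_{2,\mathbb{F}_p}\to W_{2,\mathbb{F}_p}$, $(x,y)\mapsto(x^p,y^p)-(x,y)$ (a $W_2(\mathbb{F}_p)$-covering), and $\chi$; for $f,g\in\mathbb{F}_q[s]$, $\mathcal{L}_\chi(f(s),g(s))$ is its pull-back along $\mathbb{A}^1_{\mathbb{F}_q}\to W_{2,\mathbb{F}_q}$, $s\mapsto(f(s),g(s))$. *)

theory Defs
  imports
    "HOL-Algebra.Algebraic_Closure_Type"
    "HOL-Algebra.Ideal_Product"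
    "HOL-Algebra.QuotRing"
    "HOL-Algebra.Generated_Rings"
    "HOL-Library.Cardinality"
begin

section \<open>The coefficient field: an algebraic closure of the field of \<open>\<ell>\<close>-adic numbers\<close>

text \<open>The prime is the cardinality of the type argument. The integers are the inverse limit of the
  rings of residues modulo powers of that prime; the component \<open>f n\<close> is the representative of the residue
  class modulo the \<open>n\<close>-th power in the standard range, which the defining condition forces.\<close>

class prime_card = assumes prime_card: "Factorial_Ring.prime (CARD('a))"

abbreviation ell :: "'l::prime_card itself \<Rightarrow> int" where
  "ell T \<equiv> int (CARD('l))"

typedef (overloaded) ('l::prime_card) padic_int =
  "{f :: nat \<Rightarrow> int. \<forall>n. f n = f (Suc n) mod ell TYPE('l) ^ n}"
  by (rule exI[of _ "\<lambda>_. 0"]) simp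

setup_lifting type_definition_padic_int

lemma padic_mod_mod:
  fixes c :: int shows "x mod c ^ Suc n mod c ^ n = x mod c ^ n"
  by (rule mod_mod_cancel) (simp add: le_imp_power_dvd)

lemma padic_add:
  fixes f g :: "nat \<Rightarrow> int"
  assumes "\<And>n. f n = f (Suc n) mod c ^ n" "\<And>n. g n = g (Suc n) mod c ^ n"
  shows "(f n + g n) mod c ^ n = (f (Suc n) + g (Suc n)) mod c ^ Suc n mod c ^ n"
  unfolding padic_mod_mod by (subst (1) assms(1), subst (1) assms(2)) (rule mod_add_eq)

lemma padic_diff:
  fixes f g :: "nat \<Rightarrow> int"
  assumes "\<And>n. f n = f (Suc n) mod c ^ n" "\<And>n. g n = g (Suc n) mod c ^ n"
  shows "(f n - g n) mod c ^ n = (f (Suc n) - g (Suc n)) mod c ^ Suc n mod c ^ n"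
  unfolding padic_mod_mod by (subst (1) assms(1), subst (1) assms(2)) (rule mod_diff_eq)

lemma padic_mult:
  fixes f g :: "nat \<Rightarrow> int"
  assumes "\<And>n. f n = f (Suc n) mod c ^ n" "\<And>n. g n = g (Suc n) mod c ^ n"
  shows "(f n * g n) mod c ^ n = (f (Suc n) * g (Suc n)) mod c ^ Suc n mod c ^ n"
  unfolding padic_mod_mod by (subst (1) assms(1), subst (1) assms(2)) (rule mod_mult_eq)

lemma padic_minus:
  fixes f :: "nat \<Rightarrow> int"
  assumes "\<And>n. f n = f (Suc n) mod c ^ n"
  shows "(- f n) mod c ^ n = (- f (Suc n)) mod c ^ Suc n mod c ^ n"
  unfolding padic_mod_mod by (subst (1) assms(1)) (rule mod_minus_eq)

lemma padic_reduced:
  fixes f :: "nat \<Rightarrow> int"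
  assumes "\<forall>n. f n = f (Suc n) mod c ^ n"
  shows "f n mod c ^ n = f n"
  using assms by (metis mod_mod_trivial)

instantiation padic_int :: (prime_card) comm_ring_1
begin

lift_definition zero_padic_int :: "'a padic_int" is "\<lambda>_. 0" by simp

lift_definition one_padic_int :: "'a padic_int" is "\<lambda>n. 1 mod ell TYPE('a) ^ n"
  by (simp only: padic_mod_mod)

lift_definition plus_padic_int :: "'a padic_int \<Rightarrow> 'a padic_int \<Rightarrow> 'a padic_int"
  is "\<lambda>f g n. (f n + g n) mod ell TYPE('a) ^ n"
  by (intro allI padic_add) blast+

lift_definition uminus_padic_int :: "'a padic_int \<Rightarrow> 'a padic_int"
  is "\<lambda>f n. (- f n) mod ell TYPE('a) ^ n"
  by (intro allI padic_minus) blast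

lift_definition minus_padic_int :: "'a padic_int \<Rightarrow> 'a padic_int \<Rightarrow> 'a padic_int"
  is "\<lambda>f g n. (f n - g n) mod ell TYPE('a) ^ n"
  by (intro allI padic_diff) blast+

lift_definition times_padic_int :: "'a padic_int \<Rightarrow> 'a padic_int \<Rightarrow> 'a padic_int"
  is "\<lambda>f g n. (f n * g n) mod ell TYPE('a) ^ n"
  by (intro allI padic_mult) blast+

instance
proof
  fix a b c :: "'a padic_int"
  show "a * b * c = a * (b * c)"
    by transfer (simp (no_asm) only: mod_mult_left_eq mod_mult_right_eq mult.assoc)
  show "a * b = b * a"
    by transfer (simp (no_asm) only: mult.commute)
  show "1 * a = a"
    by transfer (rule ext, simp (no_asm) only: mod_mult_left_eq mult_1_left, rule padic_reduced)
  show "a + b + c = a + (b + c)"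
    by transfer (simp (no_asm) only: mod_add_left_eq mod_add_right_eq add.assoc)
  show "a + b = b + a"
    by transfer (simp (no_asm) only: add.commute)
  show "0 + a = a"
    by transfer (rule ext, simp (no_asm) only: add_0_left, rule padic_reduced)
  show "- a + a = 0"
    by transfer (simp (no_asm) only: mod_add_left_eq left_minus mod_0)
  show "a - b = a + - b"
    by transfer (simp (no_asm) only: mod_add_right_eq diff_conv_add_uminus)
  show "(a + b) * c = a * c + b * c"
    by transfer (simp (no_asm) only: mod_mult_left_eq mod_add_eq distrib_right)
  have "(0::int) \<noteq> 1 mod ell TYPE('a) ^ 1"
    using prime_gt_1_nat[OF prime_card[where 'a='a]] by simp
  then show "(0::'a padic_int) \<noteq> 1"
    by transfer metis
qed

end

lemma prime_power_dvd_mult_cases: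
  fixes c x y :: int
  assumes c: "Factorial_Ring.prime c" and d: "c ^ (m + n) dvd x * y"
  shows "c ^ m dvd x \<or> c ^ n dvd y"
proof (cases "x = 0 \<or> y = 0")
  case False
  have u: "\<not> is_unit c" using c not_prime_unit by blast
  have "m + n \<le> multiplicity c x + multiplicity c y"
    using d False c u
    by (simp add: power_dvd_iff_le_multiplicity prime_elem_multiplicity_mult_distrib[OF prime_imp_prime_elem])
  then have "m \<le> multiplicity c x \<or> n \<le> multiplicity c y" by linarith
  then show ?thesis using multiplicity_dvd' by blast
qed auto

lemma padic_component_mod:
  fixes f :: "nat \<Rightarrow> int"
  assumes "\<forall>n. f n = f (Suc n) mod c ^ n"
  shows "f (n + k) mod c ^ n = f n"
proof (induction k)
  case 0
  show ?case using padic_reduced[OF assms] by simp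
next
  case (Suc k)
  have "f (n + k) mod c ^ n = f (Suc (n + k)) mod c ^ (n + k) mod c ^ n"
    using assms by metis
  also have "\<dots> = f (Suc (n + k)) mod c ^ n"
    by (rule mod_mod_cancel) (simp add: le_imp_power_dvd)
  finally show ?case using Suc by simp
qed

lemma padic_mult_nonzero:
  fixes f g :: "nat \<Rightarrow> int"
  assumes f: "\<forall>n. f n = f (Suc n) mod c ^ n" and g: "\<forall>n. g n = g (Suc n) mod c ^ n"
    and nz: "f \<noteq> (\<lambda>_. 0)" "g \<noteq> (\<lambda>_. 0)" and c: "Factorial_Ring.prime c"
  shows "(\<lambda>n. f n * g n mod c ^ n) \<noteq> (\<lambda>_. 0)"
proof -
  obtain m n where mn: "f m \<noteq> 0" "g n \<noteq> 0" using nz by blast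
  have "\<not> c ^ m dvd f (m + n)"
    using mn(1) padic_component_mod[OF f, of m n] by (simp add: dvd_eq_mod_eq_0)
  moreover have "\<not> c ^ n dvd g (m + n)"
    using mn(2) padic_component_mod[OF g, of n m] by (simp add: dvd_eq_mod_eq_0 add.commute)
  ultimately have "f (m + n) * g (m + n) mod c ^ (m + n) \<noteq> 0"
    using prime_power_dvd_mult_cases[OF c] by (simp only: dvd_eq_mod_eq_0[symmetric]) blast
  then show ?thesis by metis
qed

instance padic_int :: (prime_card) idom
proof
  fix a b :: "'a padic_int"
  have "Factorial_Ring.prime (ell TYPE('a))" using prime_card[where 'a='a] by simp
  then show "a \<noteq> 0 \<Longrightarrow> b \<noteq> 0 \<Longrightarrow> a * b \<noteq> 0"
    by transfer (rule padic_mult_nonzero)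
qed

type_synonym 'l padic = "'l padic_int fract"
type_synonym 'l Qlbar = "'l padic alg_closure"


section \<open>Finite fields and characters\<close>

text \<open>The type \<open>'k\<close> plays the role of an algebraic closure of a finite field. Inside an algebraically
  closed field of characteristic 2, the set \<open>GF q\<close> is the subfield with \<open>q\<close> elements if \<open>q > 1\<close> is a
  power of 2.\<close>

definition GF :: "nat \<Rightarrow> 'k::field set" where
  "GF q = {x. x ^ q = x}"

definition algebraic_over :: "'k::field set \<Rightarrow> bool" where
  "algebraic_over K \<longleftrightarrow>
    (\<forall>x. \<exists>P. P \<noteq> 0 \<and> (\<forall>i. Polynomial.coeff P i \<in> K) \<and> poly P x = 0)"

definition poly_over :: "'k::field set \<Rightarrow> 'k poly set" where
  "poly_over K = {P. \<forall>i. Polynomial.coeff P i \<in> K}"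

definition proot :: "nat \<Rightarrow> 'k::field \<Rightarrow> 'k" where
  "proot p u = (THE v. v ^ p = u)"

definition ftrace :: "nat \<Rightarrow> nat \<Rightarrow> 'k::field \<Rightarrow> 'k" where
  "ftrace p n x = (\<Sum>i<n. x ^ (p ^ i))"

definition add_group_on :: "'k::field set \<Rightarrow> 'k monoid" where
  "add_group_on V = \<lparr>carrier = V, monoid.mult = (+), one = 0\<rparr>"

definition dual :: "('g, 'm) monoid_scheme \<Rightarrow> ('g \<Rightarrow> 'E::field) set" where
  "dual G = hom G (units_of ring_of_type_algebra)"

section \<open>The Heisenberg group\<close>

definition linearized :: "nat \<Rightarrow> nat \<Rightarrow> 'k::field poly set" where
  "linearized p q =
    {P. \<exists>N c. (\<forall>i. c i \<in> GF q) \<and> P = (\<Sum>i<N. Polynomial.monom (c i) (p ^ i))}"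

definition Ker :: "'k::field poly \<Rightarrow> 'k set" where
  "Ker g = {x. poly g x = 0}"

definition lin_poly :: "nat \<Rightarrow> nat \<Rightarrow> (nat \<Rightarrow> 'k::field) \<Rightarrow> 'k poly" where
  "lin_poly p e a = (\<Sum>i\<le>e. Polynomial.monom (a i) (p ^ i))"

definition E_fun :: "nat \<Rightarrow> nat \<Rightarrow> (nat \<Rightarrow> 'k::field) \<Rightarrow> 'k \<Rightarrow> 'k" where
  "E_fun p e a x = poly (lin_poly p e a) x ^ (p ^ e) + (\<Sum>i\<le>e. (a i * x) ^ (p ^ (e - i)))"

definition f_fun :: "nat \<Rightarrow> nat \<Rightarrow> (nat \<Rightarrow> 'k::field) \<Rightarrow> 'k \<Rightarrow> 'k \<Rightarrow> 'k" where
  "f_fun p e a x y =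
    - (\<Sum>i<e. (\<Sum>j<e - i. (a i * x ^ (p ^ i) * y) ^ (p ^ j))
              + (x * poly (lin_poly p e a) y) ^ (p ^ i))"

definition C_curve :: "nat \<Rightarrow> nat \<Rightarrow> (nat \<Rightarrow> 'k::field) \<Rightarrow> ('k \<times> 'k) set" where
  "C_curve p e a = {(x, y). y ^ p - y = x * poly (lin_poly p e a) x}"

definition heis_act :: "nat \<Rightarrow> nat \<Rightarrow> (nat \<Rightarrow> 'k::field) \<Rightarrow> 'k \<times> 'k \<Rightarrow> 'k \<times> 'k \<Rightarrow> 'k \<times> 'k" where
  "heis_act p e a P g = (fst P + fst g, snd P + snd g + f_fun p e a (fst P) (fst g))"

definition heis :: "nat \<Rightarrow> nat \<Rightarrow> (nat \<Rightarrow> 'k::field) \<Rightarrow> ('k \<times> 'k) monoid" where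
  "heis p e a =
    \<lparr>carrier = {(x, y). E_fun p e a x = 0 \<and> y ^ p - y = x * poly (lin_poly p e a) x},
     monoid.mult = heis_act p e a, one = (0, 0)\<rparr>"

definition abelian_subgroup :: "'g set \<Rightarrow> 'g monoid \<Rightarrow> bool" where
  "abelian_subgroup A G \<longleftrightarrow> subgroup A G \<and> (\<forall>x\<in>A. \<forall>y\<in>A. x \<otimes>\<^bsub>G\<^esub> y = y \<otimes>\<^bsub>G\<^esub> x)"

definition maximal_abelian_subgroup :: "'g set \<Rightarrow> 'g monoid \<Rightarrow> bool" where
  "maximal_abelian_subgroup A G \<longleftrightarrow>
    abelian_subgroup A G \<and> (\<forall>B. abelian_subgroup B G \<and> A \<subseteq> B \<longrightarrow> B = A)"

section \<open>Witt vectors of length 2 in characteristic 2 and the Lang torsor\<close>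

definition witt_add :: "'k::field \<times> 'k \<Rightarrow> 'k \<times> 'k \<Rightarrow> 'k \<times> 'k" where
  "witt_add u v = (fst u + fst v, snd u + snd v + fst u * fst v)"

text \<open>The additive group of length-2 Witt vectors with components in \<open>K\<close>.\<close>

definition witt2 :: "'k::field set \<Rightarrow> ('k \<times> 'k) monoid" where
  "witt2 K = \<lparr>carrier = K \<times> K, monoid.mult = witt_add, one = (0, 0)\<rparr>"

definition lang :: "nat \<Rightarrow> 'k::field \<times> 'k \<Rightarrow> 'k \<times> 'k" where
  "lang p u = witt_add (fst u ^ p, snd u ^ p) (inv\<^bsub>witt2 UNIV\<^esub> u)"

section \<open>Etale sheaves on the affine line\<close>

text \<open>The site is that of all affine schemes etale over \<open>\<bbbA>\<^sup>1 = Spec K[s]\<close>, where \<open>K\<close> is a finite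
  subfield of \<open>'k\<close>; a sheaf on the small etale site is determined by its restriction to it. An object is
  given by a ring together with its structure map from \<open>K[s]\<close>. Algebras of finite type over \<open>K[s]\<close> are
  countable, so a carrier in \<open>nat\<close> is no restriction.\<close>

type_synonym 'k alg = "nat ring \<times> ('k poly \<Rightarrow> nat)"

definition poly_ring_over :: "'k::field set \<Rightarrow> 'k poly ring" where
  "poly_ring_over K = ring_of_type_algebra\<lparr>carrier := poly_over K\<rparr>"

definition is_alg :: "'k::field set \<Rightarrow> nat ring \<times> ('k poly \<Rightarrow> nat) \<Rightarrow> bool" where
  "is_alg K B \<longleftrightarrow> cring (fst B) \<and> snd B \<in> ring_hom (poly_ring_over K) (fst B)"

definition alg_hom ::
  "'k::field set \<Rightarrow> ('b ring \<times> ('k poly \<Rightarrow> 'b)) \<Rightarrow> ('c ring \<times> ('k poly \<Rightarrow> 'c)) \<Rightarrow> ('b \<Rightarrow> 'c) set" where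
  "alg_hom K B C =
    {w \<in> ring_hom (fst B) (fst C) \<inter> extensional (carrier (fst B)).
      \<forall>P\<in>poly_over K. w (snd B P) = snd C P}"

definition alg_quot :: "nat ring \<times> ('k poly \<Rightarrow> nat) \<Rightarrow> nat set \<Rightarrow> nat set ring \<times> ('k poly \<Rightarrow> nat set)" where
  "alg_quot C I = (fst C Quot I, \<lambda>P. I +>\<^bsub>fst C\<^esub> snd C P)"

definition finite_type :: "'k::field set \<Rightarrow> 'k alg \<Rightarrow> bool" where
  "finite_type K B \<longleftrightarrow>
    (\<exists>S. finite S \<and> S \<subseteq> carrier (fst B) \<and>
      carrier (fst B) = generate_ring (fst B) (snd B ` poly_over K \<union> S))"

text \<open>The infinitesimal lifting property. It suffices to test it on countable algebras \<open>C\<close>, as \<open>B\<close> will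
  be of finite type.\<close>

definition formally_etale :: "'k::field set \<Rightarrow> 'k alg \<Rightarrow> bool" where
  "formally_etale K B \<longleftrightarrow>
    (\<forall>C I. is_alg K C \<and> ideal I (fst C) \<and> I \<cdot>\<^bsub>fst C\<^esub> I = {\<zero>\<^bsub>fst C\<^esub>} \<longrightarrow>
      (\<forall>v\<in>alg_hom K B (alg_quot C I).
        \<exists>!u. u \<in> alg_hom K B C \<and> (\<forall>b\<in>carrier (fst B). I +>\<^bsub>fst C\<^esub> u b = v b)))"

text \<open>\<open>K[s]\<close> is noetherian, hence finite type and finite presentation agree.\<close>

definition etale_algs :: "'k::field set \<Rightarrow> 'k alg set" where
  "etale_algs K = {B. is_alg K B \<and> finite_type K B \<and> formally_etale K B}"

text \<open>Presheaves of vector spaces over \<open>'E\<close> whose sections over each object form a space of functions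
  \<open>'z \<Rightarrow> 'E\<close> with the pointwise structure. In \<open>restr F B C w\<close>, the map \<open>w\<close> is an algebra homomorphism
  from \<open>B\<close> to \<open>C\<close>, that is, a morphism from \<open>Spec C\<close> to \<open>Spec B\<close>.\<close>

record (overloaded) ('k, 'z, 'E) etale_presheaf =
  sections :: "'k alg \<Rightarrow> ('z \<Rightarrow> 'E) set"
  restr :: "'k alg \<Rightarrow> 'k alg \<Rightarrow> (nat \<Rightarrow> nat) \<Rightarrow> ('z \<Rightarrow> 'E) \<Rightarrow> ('z \<Rightarrow> 'E)"

definition sheaf_iso ::
  "'k::field set \<Rightarrow> ('k, 'z, 'E::field) etale_presheaf \<Rightarrow> ('k, 'y, 'E) etale_presheaf \<Rightarrow> bool" where
  "sheaf_iso K F G \<longleftrightarrow>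
    (\<exists>\<eta>. (\<forall>B\<in>etale_algs K.
             bij_betw (\<eta> B) (sections F B) (sections G B) \<and>
             (\<forall>h\<in>sections F B. \<forall>h'\<in>sections F B.
                \<eta> B (\<lambda>z. h z + h' z) = (\<lambda>z. \<eta> B h z + \<eta> B h' z)) \<and>
             (\<forall>c. \<forall>h\<in>sections F B. \<eta> B (\<lambda>z. c * h z) = (\<lambda>z. c * \<eta> B h z))) \<and>
          (\<forall>B\<in>etale_algs K. \<forall>C\<in>etale_algs K. \<forall>w\<in>alg_hom K B C. \<forall>h\<in>sections F B.
             \<eta> C (restr F B C w h) = restr G B C w (\<eta> B h)))"

section \<open>The sheaf associated with a Galois covering and a character\<close>

text \<open>A scheme of finite type over the finite field \<open>K\<close> is handled through its points with values in the
  algebraic closure \<open>'k\<close>, with the Zariski topology defined by functions over \<open>K\<close>. As the orbits of these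
  points under the Galois group of \<open>K\<close> are the closed points of the scheme, a function that is locally
  constant for this topology is the same as a locally constant function on the scheme.\<close>

definition alg_points :: "'k::field set \<Rightarrow> 'k alg \<Rightarrow> (nat \<Rightarrow> 'k) set" where
  "alg_points K B =
    {u \<in> ring_hom (fst B) ring_of_type_algebra \<inter> extensional (carrier (fst B)).
      \<forall>c\<in>K. u (snd B [:c:]) = c}"

definition coord :: "'k::field alg \<Rightarrow> (nat \<Rightarrow> 'k) \<Rightarrow> 'k" where
  "coord B u = u (snd B [:0, 1:])"

definition polyfun2 :: "'k::field set \<Rightarrow> ('k \<times> 'k \<Rightarrow> 'k) set" where
  "polyfun2 K = {\<lambda>P. \<Sum>i<N. \<Sum>j<N. c i j * fst P ^ i * snd P ^ j | N c. \<forall>i j. c i j \<in> K}"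

text \<open>The regular functions over \<open>K\<close> on the product of the affine plane and \<open>Spec B\<close>.\<close>

definition regular_funs :: "'k::field set \<Rightarrow> 'k alg \<Rightarrow> (('k \<times> 'k) \<times> (nat \<Rightarrow> 'k) \<Rightarrow> 'k) set" where
  "regular_funs K B =
    {\<lambda>z. \<Sum>i<N. m i (fst z) * snd z (b i) | (N::nat) m b.
      \<forall>i<N. m i \<in> polyfun2 K \<and> b i \<in> carrier (fst B)}"

definition locally_constant_on :: "'z set \<Rightarrow> ('z \<Rightarrow> 'k::field) set \<Rightarrow> ('z \<Rightarrow> 'E) \<Rightarrow> bool" where
  "locally_constant_on Z R h \<longleftrightarrow>
    (\<forall>z\<in>Z. \<exists>g\<in>R. g z \<noteq> 0 \<and> (\<forall>z'\<in>Z. g z' \<noteq> 0 \<longrightarrow> h z' = h z))"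

text \<open>For \<open>\<pi> : Y \<rightarrow> X\<close> and \<open>\<kappa> : \<bbbA>\<^sup>1 \<rightarrow> X\<close>: the fibre product of \<open>Y\<close> and \<open>Spec B\<close> over \<open>X\<close>.\<close>

definition fibre_prod ::
  "'k::field set \<Rightarrow> ('k \<times> 'k) set \<Rightarrow> ('k \<times> 'k \<Rightarrow> 'x) \<Rightarrow> ('k \<Rightarrow> 'x) \<Rightarrow> 'k alg
    \<Rightarrow> (('k \<times> 'k) \<times> (nat \<Rightarrow> 'k)) set" where
  "fibre_prod K Y \<pi> \<kappa> B = {(P, u). P \<in> Y \<and> u \<in> alg_points K B \<and> \<pi> P = \<kappa> (coord B u)}"

text \<open>Let \<open>\<pi> : Y \<rightarrow> X\<close> be a Galois covering whose group \<open>G\<close> acts on \<open>Y\<close> from the right, where \<open>Y\<close> is a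
  closed subscheme of the affine plane, and let \<open>\<chi>\<close> be a character of \<open>G\<close>. The sheaf associated with
  \<open>\<chi>\<close> has as sections over an \<open>X\<close>-scheme \<open>U\<close> the locally constant functions \<open>h\<close> on the fibre product of
  \<open>Y\<close> and \<open>U\<close> over \<open>X\<close> with \<open>h (P \<cdot> g) = \<chi> g * h P\<close>. The following is its inverse image under
  \<open>\<kappa> : \<bbbA>\<^sup>1 \<rightarrow> X\<close>, so \<open>U = Spec B\<close> is regarded as an \<open>X\<close>-scheme by means of \<open>\<kappa>\<close>. (Inverse images of such
  sheaves, which are represented by etale \<open>X\<close>-schemes, are given by base change.) Sections are extended
  by zero outside the fibre product.

  The sign of the exponent of \<open>\<chi> g\<close> is Deligne's convention: the stalk at a geometric point consists of
  the equivariant functions \<open>h\<close> on the fibre of \<open>Y\<close>, a Galois automorphism \<open>\<sigma>\<close> sends \<open>h\<close> to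
  \<open>\<lambda>P. h (\<sigma>\<^sup>-\<^sup>1 P)\<close>, so the geometric Frobenius sends it to \<open>\<lambda>P. h (Frob P)\<close>, which is \<open>\<chi> g * h P\<close> if
  \<open>Frob P = P \<cdot> g\<close>.\<close>

definition assoc_sheaf ::
  "'k::field set \<Rightarrow> ('k \<times> 'k) set \<Rightarrow> ('k \<times> 'k \<Rightarrow> 'x) \<Rightarrow> 'g set \<Rightarrow> ('k \<times> 'k \<Rightarrow> 'g \<Rightarrow> 'k \<times> 'k)
    \<Rightarrow> ('g \<Rightarrow> 'E::field) \<Rightarrow> ('k \<Rightarrow> 'x)
    \<Rightarrow> ('k, ('k \<times> 'k) \<times> (nat \<Rightarrow> 'k), 'E) etale_presheaf" where
  "assoc_sheaf K Y \<pi> G act \<chi> \<kappa> =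
    \<lparr>sections = (\<lambda>B.
       {h. locally_constant_on (fibre_prod K Y \<pi> \<kappa> B) (regular_funs K B) h \<and>
           (\<forall>(P, u)\<in>fibre_prod K Y \<pi> \<kappa> B. \<forall>g\<in>G. h (act P g, u) = \<chi> g * h (P, u)) \<and>
           (\<forall>z. z \<notin> fibre_prod K Y \<pi> \<kappa> B \<longrightarrow> h z = 0)}),
     restr = (\<lambda>B C w h (P, u).
       if (P, u) \<in> fibre_prod K Y \<pi> \<kappa> C
       then h (P, restrict (u \<circ> w) (carrier (fst B))) else 0)\<rparr>"

text \<open>The sheaf on \<open>\<bbbA>\<^sup>1\<close> associated with the \<open>A\<close>-covering \<open>(x, y) \<mapsto> FA x\<close> of \<open>\<bbbA>\<^sup>1\<close> by the curve.\<close>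

definition Q_sheaf where
  "Q_sheaf q p e a A FA \<xi> =
    assoc_sheaf (GF q) (C_curve p e a) (\<lambda>P. poly FA (fst P)) A (heis_act p e a) \<xi> (\<lambda>s. s)"

text \<open>The inverse image, under \<open>s \<mapsto> (f s, g s)\<close>, of the sheaf associated with the Lang torsor.\<close>

definition L_sheaf where
  "L_sheaf q p \<chi> f g =
    assoc_sheaf (GF q) UNIV (lang p) (carrier (witt2 (GF p))) witt_add \<chi> (\<lambda>s. (poly f s, poly g s))"

end

theory Submission
  imports Defs
begin

text \<open>On the curve, \<open>z = f\<^sub>U x\<close> and \<open>w = y + \<Delta> x + \<alpha>' z\<^sup>2\<close>, where \<open>\<alpha>'\<close> is the \<open>p\<close>-th root of \<open>\<alpha>\<close>,
  satisfy \<open>L\<^sub>p (z, w) = (s, \<alpha> s\<^sup>2)\<close> for \<open>s = F\<^sub>A x\<close>. If moreover \<open>x = a t\<close>, then \<open>s = t\<^sup>q + t\<close>, and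
  \<open>v = Tr (\<beta> t)\<close> satisfies \<open>v\<^sup>p + v = \<beta> s\<close>. Hence \<open>(z, w + v)\<close> lies on the pulled back Lang torsor, and
  the points \<open>(t, y)\<close> define a correspondence between the two coverings over the \<open>s\<close>-line. Two pairs of
  corresponding points over the same \<open>s\<close> differ by elements of the two groups on which \<open>\<xi>\<close> and
  \<open>\<xi>\<^sub>W\<close> agree, so equivariant functions can be carried from one side to the other. Local constancy
  is preserved because both projections of the correspondence are finite, flat and open.\<close>

section \<open>Polynomial functions on the plane\<close>

lemma poly_surj_alg_closed:
  fixes P :: "'k::alg_closed_field poly"
  assumes "Polynomial.degree P > 0"
  shows "\<exists>t. poly P t = z"
proof -
  have "Polynomial.degree (P + [:-z:]) > 0"
    using assms by (simp add: degree_add_eq_left)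
  then obtain t where "poly (P + [:-z:]) t = 0"
    using alg_closed_imp_poly_has_root by blast
  then show ?thesis by (auto simp: eq_neg_iff_add_eq_0 add_eq_0_iff)
qed

text \<open>\<open>b - [:z:]\<close> has the same nowhere vanishing derivative as \<open>b\<close>,
  so its roots are all simple. The count of fibre points is used in
  \<open>locally_constant_descent\<close>.\<close>

lemma card_fibre_separable:
  fixes b :: "'k::alg_closed_field poly"
  assumes deg: "Polynomial.degree b > 0" and sep: "\<And>t. poly (pderiv b) t \<noteq> 0"
  shows "card {t. poly b t = z} = Polynomial.degree b"
proof -
  define P where "P = b - [:z:]"
  have degP: "Polynomial.degree P = Polynomial.degree b"
    unfolding P_def diff_conv_add_uminus using deg by (subst degree_add_eq_left) auto
  have P0: "P \<noteq> 0" using deg degP by auto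
  have derP: "pderiv P = pderiv b" by (simp add: P_def pderiv_diff pderiv_pCons)
  obtain M where M: "size M = Polynomial.degree P"
    "P = smult (lead_coeff P) (\<Prod>x\<in>#M. [:-x, 1:])"
    using alg_closed_imp_factorization[OF P0] by blast
  have c1: "count M x \<le> 1" for x
  proof (rule ccontr)
    assume "\<not> count M x \<le> 1"
    then have "replicate_mset 2 x \<subseteq># M"
      by (simp add: count_le_replicate_mset_subset_eq[symmetric])
    then obtain N where N: "M = {#x, x#} + N"
      by (auto simp: numeral_2_eq_2 subset_mset.le_iff_add)
    \<comment> \<open>A squared linear factor would make the derivative vanish at
      \<open>x\<close>.\<close>
    have "P = [:-x, 1:] * ([:-x, 1:] * smult (lead_coeff P) (\<Prod>x\<in>#N. [:-x, 1:]))"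
      by (subst M(2)) (simp add: N mult.assoc mult_smult_right del: mult_pCons_left)
    then obtain Q where Q: "P = [:-x, 1:] * ([:-x, 1:] * Q)" by blast
    have "poly (pderiv P) x = 0"
      by (subst Q) (simp add: pderiv_mult del: mult_pCons_left)
    then show False using sep derP by metis
  qed
  have "set_mset M = {t. poly P t = 0}"
  proof -
    have "poly P t = lead_coeff P * (\<Prod>x\<in>#M. t - x)" for t
      by (subst M(2)) (simp add: poly_prod_mset image_mset.compositionality o_def)
    then show ?thesis using P0 by (auto simp: prod_mset_zero_iff)
  qed
  moreover have "size M = card (set_mset M)"
  proof -
    have "count M x = 1" if "x \<in># M" for x
      using c1[of x] that by (metis One_nat_def Suc_leI antisym count_greater_zero_iff)
    then show ?thesis by (simp add: size_multiset_overloaded_eq)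
  qed
  ultimately show ?thesis using M(1) degP by (simp add: P_def)
qed

text \<open>A nonconstant polynomial takes every value, in particular one that the
  \<open>p\<close>-th power map moves.\<close>

lemma const_of_power_eq:
  fixes P :: "'k::alg_closed_field poly"
  assumes p: "p > 1" and P: "\<And>x. poly P x ^ p = poly P x"
  shows "poly P x = poly P 0"
proof (cases "Polynomial.degree P = 0")
  case True
  then obtain c where "P = [:c:]" using degree_eq_zeroE by blast
  then show ?thesis by simp
next
  case False
  \<comment> \<open>A root \<open>c\<close> of \<open>Q\<close> satisfies
    \<open>c ^ p = c + 1\<close>, so it is not fixed.\<close>
  define Q :: "'k poly" where "Q = Polynomial.monom 1 p - [:1, 1:]"
  have "Polynomial.degree Q = p"
    unfolding Q_def diff_conv_add_uminus using p
    by (subst degree_add_eq_left) (auto simp: degree_monom_eq)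
  then obtain c where "poly Q c = 0" using alg_closed_imp_poly_has_root[of Q] p by auto
  then have "c ^ p \<noteq> c" by (auto simp: Q_def poly_monom)
  moreover obtain t where "poly P t = c" using poly_surj_alg_closed[of P c] False by auto
  ultimately show ?thesis using P by blast
qed

section \<open>Polynomial and regular functions with coefficients in a subfield\<close>

locale subfield_of =
  fixes K :: "'k::field set"
  assumes zero: "0 \<in> K" and one: "1 \<in> K"
    and add: "x \<in> K \<Longrightarrow> y \<in> K \<Longrightarrow> x + y \<in> K"
    and mult: "x \<in> K \<Longrightarrow> y \<in> K \<Longrightarrow> x * y \<in> K"
    and uminus: "x \<in> K \<Longrightarrow> - x \<in> K"
    and inverse: "x \<in> K \<Longrightarrow> inverse x \<in> K"
begin

lemma sum_closed: "(\<And>i. i \<in> I \<Longrightarrow> f i \<in> K) \<Longrightarrow> sum f I \<in> K"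
  by (induction I rule: infinite_finite_induct) (auto simp: zero add)

lemma poly_over_add: "P \<in> poly_over K \<Longrightarrow> Q \<in> poly_over K \<Longrightarrow> P + Q \<in> poly_over K"
  by (simp add: poly_over_def add)

lemma poly_over_const: "c \<in> K \<Longrightarrow> [:c:] \<in> poly_over K"
  by (simp add: poly_over_def coeff_pCons zero split: nat.split)

lemma poly_over_mult: "P \<in> poly_over K \<Longrightarrow> Q \<in> poly_over K \<Longrightarrow> P * Q \<in> poly_over K"
  by (auto simp: poly_over_def coeff_mult intro!: sum_closed mult)

lemma poly_over_sum: "(\<And>i. i \<in> I \<Longrightarrow> f i \<in> poly_over K) \<Longrightarrow> sum f I \<in> poly_over K"
  by (induction I rule: infinite_finite_induct) (auto simp: poly_over_add, simp_all add: poly_over_def zero)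

lemma poly_over_monom: "c \<in> K \<Longrightarrow> Polynomial.monom c i \<in> poly_over K"
  by (simp add: poly_over_def zero)

lemma poly_over_X: "[:0, 1:] \<in> poly_over K"
  by (simp add: poly_over_def coeff_pCons zero one split: nat.split)

lemma poly_over_pcompose:
  assumes "P \<in> poly_over K" "Q \<in> poly_over K"
  shows "pcompose P Q \<in> poly_over K"
  using assms(1)
proof (induction P)
  case 0
  then show ?case by simp
next
  case (pCons c P)
  from pCons.prems have "poly.coeff (pCons c P) (Suc i) \<in> K" "poly.coeff (pCons c P) 0 \<in> K" for i
    unfolding poly_over_def by blast+
  then have "P \<in> poly_over K" "c \<in> K" by (simp_all add: poly_over_def)
  then show ?case
    using pCons.IH assms(2) by (simp add: pcompose_pCons poly_over_add poly_over_const poly_over_mult)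
qed

lemma monomial_polyfun2: "c \<in> K \<Longrightarrow> (\<lambda>P. c * fst P ^ i * snd P ^ j) \<in> polyfun2 K"
proof -
  assume c: "c \<in> K"
  \<comment> \<open>The coefficient array in \<open>polyfun2\<close> is square, so its side must
    exceed both exponents.\<close>
  define N where "N = Suc (max i j)"
  define d where "d = (\<lambda>k l. if k = i \<and> l = j then c else 0)"
  have "(\<Sum>k<N. \<Sum>l<N. d k l * x ^ k * y ^ l) = c * x ^ i * y ^ j" for x y
  proof -
    have "(\<Sum>k<N. \<Sum>l<N. d k l * x ^ k * y ^ l)
        = (\<Sum>k<N. if k = i then (\<Sum>l<N. if l = j then c * x ^ i * y ^ j else 0) else 0)"
    proof (intro sum.cong refl)
      fix k
      show "(\<Sum>l<N. d k l * x ^ k * y ^ l)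
          = (if k = i then (\<Sum>l<N. if l = j then c * x ^ i * y ^ j else 0) else 0)"
        by (cases "k = i") (simp_all add: d_def if_distrib[of "\<lambda>v. v * _"] cong: if_cong)
    qed
    then show ?thesis by (simp add: N_def)
  qed
  moreover have "\<forall>k l. d k l \<in> K" by (simp add: d_def c zero)
  ultimately show ?thesis unfolding polyfun2_def mem_Collect_eq
    by (intro exI[of _ N] exI[of _ d]) simp
qed

lemma polyfun2_const: "c \<in> K \<Longrightarrow> (\<lambda>P. c) \<in> polyfun2 K"
  using monomial_polyfun2[of c 0 0] by simp

lemma polyfun2_fst: "fst \<in> polyfun2 K"
  using monomial_polyfun2[of 1 1 0] one by (simp add: eta_contract_eq)

lemma polyfun2_snd: "snd \<in> polyfun2 K"
  using monomial_polyfun2[of 1 0 1] one by (simp add: eta_contract_eq)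

lemma polyfun2_add:
  assumes "f \<in> polyfun2 K" "g \<in> polyfun2 K"
  shows "(\<lambda>P. f P + g P) \<in> polyfun2 K"
proof -
  obtain M c where c: "f = (\<lambda>P. \<Sum>i<M. \<Sum>j<M. c i j * fst P ^ i * snd P ^ j)" "\<forall>i j. c i j \<in> K"
    using assms(1) by (auto simp: polyfun2_def)
  obtain N d where d: "g = (\<lambda>P. \<Sum>i<N. \<Sum>j<N. d i j * fst P ^ i * snd P ^ j)" "\<forall>i j. d i j \<in> K"
    using assms(2) by (auto simp: polyfun2_def)
  define L where "L = max M N"
  have pad: "(\<Sum>i<n. \<Sum>j<n. h i j * x ^ i * y ^ j)
     = (\<Sum>i<L. \<Sum>j<L. (if i < n \<and> j < n then h i j else 0) * x ^ i * y ^ j)"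
    if "n \<le> L" for n and h :: "nat \<Rightarrow> nat \<Rightarrow> 'k" and x y
  proof -
    have "(\<Sum>i<L. \<Sum>j<L. (if i < n \<and> j < n then h i j else 0) * x ^ i * y ^ j)
      = (\<Sum>i<n. \<Sum>j<L. (if i < n \<and> j < n then h i j else 0) * x ^ i * y ^ j)"
      using that by (intro sum.mono_neutral_right) auto
    also have "\<dots> = (\<Sum>i<n. \<Sum>j<n. (if i < n \<and> j < n then h i j else 0) * x ^ i * y ^ j)"
      using that by (intro sum.cong sum.mono_neutral_right) auto
    also have "\<dots> = (\<Sum>i<n. \<Sum>j<n. h i j * x ^ i * y ^ j)"
      by (intro sum.cong) auto
    finally show ?thesis by simp
  qed
  define k where "k = (\<lambda>i j. (if i < M \<and> j < M then c i j else 0) + (if i < N \<and> j < N then d i j else 0))"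
  have "(\<lambda>P. f P + g P) = (\<lambda>P. \<Sum>i<L. \<Sum>j<L. k i j * fst P ^ i * snd P ^ j)"
    unfolding c d k_def
    by (subst pad[of M], simp add: L_def, subst pad[of N], simp add: L_def)
       (simp only: distrib_right sum.distrib)
  moreover have "\<forall>i j. k i j \<in> K" using c d by (auto simp: k_def zero intro!: add)
  ultimately show ?thesis unfolding polyfun2_def mem_Collect_eq by blast
qed

lemma polyfun2_sum:
  "(\<And>i. i \<in> I \<Longrightarrow> f i \<in> polyfun2 K) \<Longrightarrow> (\<lambda>P. \<Sum>i\<in>I. f i P) \<in> polyfun2 K"
  by (induction I rule: infinite_finite_induct) (auto simp: polyfun2_const zero polyfun2_add)

lemma polyfun2_mult:
  assumes "f \<in> polyfun2 K" "g \<in> polyfun2 K"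
  shows "(\<lambda>P. f P * g P) \<in> polyfun2 K"
proof -
  obtain M c where c: "f = (\<lambda>P. \<Sum>i<M. \<Sum>j<M. c i j * fst P ^ i * snd P ^ j)" "\<forall>i j. c i j \<in> K"
    using assms(1) by (auto simp: polyfun2_def)
  obtain N d where d: "g = (\<lambda>P. \<Sum>i<N. \<Sum>j<N. d i j * fst P ^ i * snd P ^ j)" "\<forall>i j. d i j \<in> K"
    using assms(2) by (auto simp: polyfun2_def)
  have "(\<lambda>P. f P * g P) = (\<lambda>P. \<Sum>i<M. \<Sum>j<M. \<Sum>k<N. \<Sum>l<N.
      (c i j * d k l) * fst P ^ (i + k) * snd P ^ (j + l))"
    unfolding c d sum_distrib_right unfolding sum_distrib_left
    by (simp only: power_add mult_ac)
  also have "\<dots> \<in> polyfun2 K"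
    by (intro polyfun2_sum monomial_polyfun2 mult) (use c d in auto)
  finally show ?thesis .
qed

lemma polyfun2_power: "f \<in> polyfun2 K \<Longrightarrow> (\<lambda>P. f P ^ i) \<in> polyfun2 K"
  by (induction i) (simp_all add: polyfun2_const one polyfun2_mult)

lemma polyfun2_compose:
  assumes "f \<in> polyfun2 K" "(\<lambda>P. fst (F P)) \<in> polyfun2 K" "(\<lambda>P. snd (F P)) \<in> polyfun2 K"
  shows "(\<lambda>P. f (F P)) \<in> polyfun2 K"
proof -
  obtain M c where c: "f = (\<lambda>P. \<Sum>i<M. \<Sum>j<M. c i j * fst P ^ i * snd P ^ j)" "\<forall>i j. c i j \<in> K"
    using assms(1) by (auto simp: polyfun2_def)
  show ?thesis unfolding c
    by (intro polyfun2_sum polyfun2_mult polyfun2_power polyfun2_const assms) (use c in auto)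
qed

lemma polyfun2_poly:
  assumes "Q \<in> poly_over K" "f \<in> polyfun2 K"
  shows "(\<lambda>P. poly Q (f P)) \<in> polyfun2 K"
  unfolding poly_altdef
  by (intro polyfun2_sum polyfun2_mult polyfun2_power polyfun2_const assms(2))
     (use assms(1) in \<open>auto simp: poly_over_def\<close>)

text \<open>The regular functions on the \<open>(t, w)\<close>-plane form a module over those on the \<open>(b t, w)\<close>-plane
  that is generated by the powers of \<open>t\<close> below the degree of \<open>b\<close>.\<close>

lemma power_expansion:
  assumes b: "b \<in> poly_over K" and d: "d = Polynomial.degree b" "d > 0"
  shows "\<exists>c. (\<forall>j<d. c j \<in> polyfun2 K) \<and> (\<forall>t w. t ^ i = (\<Sum>j<d. c j (poly b t, w) * t ^ j))"
proof (induction i)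
  case 0
  have "(\<Sum>j<d. (if j = 0 then 1 else 0) * t ^ j) = 1" for t :: 'k
    using d(2) by (subst sum.mono_neutral_right[of _ "{0}"]) auto
  then show ?case
    by (intro exI[of _ "\<lambda>j P. if j = 0 then 1 else 0"]) (auto intro: polyfun2_const zero one)
next
  case (Suc i)
  then obtain c where c: "\<And>j. j < d \<Longrightarrow> c j \<in> polyfun2 K"
    "\<And>t w. t ^ i = (\<Sum>j<d. c j (poly b t, w) * t ^ j)" by blast
  obtain k where k: "d = Suc k" using d(2) by (cases d) auto
  define l where "l = inverse (lead_coeff b)"
  have bK: "poly.coeff b j \<in> K" for j using b by (simp add: poly_over_def)
  have lK: "l \<in> K" unfolding l_def by (intro inverse bK)
  have "b \<noteq> 0" using d by auto
  then have l: "l * lead_coeff b = 1" by (simp add: l_def)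
  \<comment> \<open>Multiplication by \<open>t\<close> shifts the coefficients up by one place. The
    overflow \<open>c k P * t ^ d\<close> is reduced by solving \<open>poly b t\<close> for
    \<open>t ^ d\<close>; \<open>fst P\<close> stands for \<open>poly b t\<close>.\<close>
  define c' where "c' = (\<lambda>j P. (case j of 0 \<Rightarrow> c k P * l * fst P | Suc j' \<Rightarrow> c j' P)
      + c k P * (- l * poly.coeff b j))"
  have "c' j \<in> polyfun2 K" if "j < d" for j
    unfolding c'_def using that k
    by (cases j; simp only: nat.case; intro polyfun2_add polyfun2_mult polyfun2_const polyfun2_fst c
        mult uminus lK bK) auto
  moreover have "t ^ Suc i = (\<Sum>j<d. c' j (poly b t, w) * t ^ j)" for t w
  proof -
    define P where "P = (poly b t, w)"
    have "poly b t = (\<Sum>j<d. poly.coeff b j * t ^ j) + lead_coeff b * t ^ d"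
      by (simp add: poly_altdef d lessThan_Suc_atMost[symmetric])
    then have "l * poly b t = l * (\<Sum>j<d. poly.coeff b j * t ^ j) + (l * lead_coeff b) * t ^ d"
      by (simp add: distrib_left mult.assoc)
    then have td: "t ^ d = l * poly b t + (\<Sum>j<d. (- l * poly.coeff b j) * t ^ j)"
      by (simp add: l sum_distrib_left sum_negf mult.assoc)
    have "t ^ Suc i = (\<Sum>j<d. c j P * t ^ Suc j)"
      using c(2)[of t w] by (simp add: P_def sum_distrib_left mult_ac)
    also have "\<dots> = (\<Sum>j<k. c j P * t ^ Suc j) + c k P * t ^ d" by (simp add: k)
    also have "\<dots> = ((c k P * l * poly b t) + (\<Sum>j<k. c j P * t ^ Suc j))
        + (\<Sum>j<d. c k P * (- l * poly.coeff b j) * t ^ j)"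
      by (subst td) (simp add: distrib_left sum_distrib_left mult_ac)
    also have "(c k P * l * poly b t) + (\<Sum>j<k. c j P * t ^ Suc j)
        = (\<Sum>j<d. (case j of 0 \<Rightarrow> c k P * l * fst P | Suc j' \<Rightarrow> c j' P) * t ^ j)"
      unfolding k sum.lessThan_Suc_shift by (simp add: P_def)
    finally show ?thesis
      by (simp only: c'_def P_def sum.distrib[symmetric] distrib_right[symmetric])
  qed
  ultimately show ?case by blast
qed

text \<open>Expanding the powers of \<open>t\<close> suffices, as the second coordinate is carried
  along unchanged.\<close>

lemma polyfun2_expansion:
  assumes b: "b \<in> poly_over K" and d: "d = Polynomial.degree b" "d > 0" and f: "f \<in> polyfun2 K"
  shows "\<exists>c. (\<forall>j<d. c j \<in> polyfun2 K) \<and> (\<forall>t w. f (t, w) = (\<Sum>j<d. c j (poly b t, w) * t ^ j))"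
proof -
  obtain N m where m: "f = (\<lambda>P. \<Sum>i<N. \<Sum>j<N. m i j * fst P ^ i * snd P ^ j)" "\<forall>i j. m i j \<in> K"
    using f by (auto simp: polyfun2_def)
  obtain c where c: "\<And>i j. j < d \<Longrightarrow> c i j \<in> polyfun2 K"
    "\<And>i t w. t ^ i = (\<Sum>j<d. c i j (poly b t, w) * t ^ j)"
    using power_expansion[OF b d] by metis
  define C where "C = (\<lambda>j P. \<Sum>i<N. \<Sum>k<N. m i k * c i j P * snd P ^ k)"
  have "C j \<in> polyfun2 K" if "j < d" for j
    unfolding C_def
    by (intro polyfun2_sum polyfun2_mult polyfun2_const polyfun2_power polyfun2_snd c that)
       (use m in auto)
  moreover have "f (t, w) = (\<Sum>j<d. C j (poly b t, w) * t ^ j)" for t w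
  proof -
    have "f (t, w) = (\<Sum>i<N. \<Sum>k<N. \<Sum>j<d. m i k * c i j (poly b t, w) * w ^ k * t ^ j)"
      unfolding m fst_conv snd_conv
      by (subst c(2)[of t _ w]) (simp add: sum_distrib_left sum_distrib_right mult_ac)
    also have "\<dots> = (\<Sum>i<N. \<Sum>j<d. \<Sum>k<N. m i k * c i j (poly b t, w) * w ^ k * t ^ j)"
      by (intro sum.cong refl sum.swap)
    also have "\<dots> = (\<Sum>j<d. \<Sum>i<N. \<Sum>k<N. m i k * c i j (poly b t, w) * w ^ k * t ^ j)"
      by (rule sum.swap)
    finally show ?thesis by (simp add: C_def sum_distrib_right)
  qed
  ultimately show ?thesis by blast
qed

text \<open>Elements of \<open>B\<close> do not involve the plane variables, so each term is
  expanded in its plane factor.\<close>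

lemma regular_funs_expansion:
  assumes b: "b \<in> poly_over K" and d: "d = Polynomial.degree b" "d > 0"
    and G: "G \<in> regular_funs K B"
  shows "\<exists>C. (\<forall>j<d. C j \<in> regular_funs K B) \<and>
    (\<forall>t w u. G ((t, w), u) = (\<Sum>j<d. C j ((poly b t, w), u) * t ^ j))"
proof -
  obtain N m bb where G': "G = (\<lambda>z. \<Sum>i<(N::nat). m i (fst z) * snd z (bb i))"
    "\<forall>i<N. m i \<in> polyfun2 K \<and> bb i \<in> carrier (fst B)"
    using G unfolding regular_funs_def by blast
  have "\<forall>i. \<exists>c. i < N \<longrightarrow> (\<forall>j<d. c j \<in> polyfun2 K) \<and>
      (\<forall>t w. m i (t, w) = (\<Sum>j<d. c j (poly b t, w) * t ^ j))"
    using polyfun2_expansion[OF b d] G'(2) by blast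
  then obtain c where c: "\<And>i j. i < N \<Longrightarrow> j < d \<Longrightarrow> c i j \<in> polyfun2 K"
    "\<And>i t w. i < N \<Longrightarrow> m i (t, w) = (\<Sum>j<d. c i j (poly b t, w) * t ^ j)" by metis
  define C where "C = (\<lambda>j z. \<Sum>i<N. c i j (fst z) * snd z (bb i))"
  have "C j \<in> regular_funs K B" if "j < d" for j
    unfolding C_def regular_funs_def mem_Collect_eq
    by (intro exI[of _ N] exI[of _ "\<lambda>i. c i j"] exI[of _ bb]) (use c that G' in auto)
  moreover have "G ((t, w), u) = (\<Sum>j<d. C j ((poly b t, w), u) * t ^ j)" for t w u
  proof -
    have "G ((t, w), u) = (\<Sum>i<N. \<Sum>j<d. c i j (poly b t, w) * t ^ j * u (bb i))"
      unfolding G' by (simp add: c sum_distrib_right)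
    also have "\<dots> = (\<Sum>j<d. \<Sum>i<N. c i j (poly b t, w) * t ^ j * u (bb i))"
      by (rule sum.swap)
    finally show ?thesis by (simp add: C_def sum_distrib_right sum_distrib_left mult_ac)
  qed
  ultimately show ?thesis by blast
qed

lemma regular_funs_compose:
  assumes G: "G \<in> regular_funs K B"
    and F: "(\<lambda>P. fst (F P)) \<in> polyfun2 K" "(\<lambda>P. snd (F P)) \<in> polyfun2 K"
  shows "(\<lambda>z. G (F (fst z), snd z)) \<in> regular_funs K B"
proof -
  obtain N m bb where G': "G = (\<lambda>z. \<Sum>i<(N::nat). m i (fst z) * snd z (bb i))"
    "\<forall>i<N. m i \<in> polyfun2 K \<and> bb i \<in> carrier (fst B)"
    using G unfolding regular_funs_def by blast
  have "\<forall>i<N. (\<lambda>P. m i (F P)) \<in> polyfun2 K \<and> bb i \<in> carrier (fst B)"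
    using G'(2) polyfun2_compose[OF _ F] by blast
  then show ?thesis unfolding regular_funs_def mem_Collect_eq G'(1)
    by (intro exI[of _ N] exI[of _ "\<lambda>i P. m i (F P)"] exI[of _ bb]) simp
qed

end

text \<open>The map \<open>(t, w) \<mapsto> (b t, w)\<close> is finite flat, with reduced fibres when \<open>b\<close> is separable. Its
  openness holds because the coefficients of \<open>G\<close> with respect to the basis \<open>1, t, \<dots>\<close> vanish at a point
  if and only if \<open>G\<close> vanishes on the fibre.\<close>

lemma locally_constant_descent:
  fixes b :: "'k::alg_closed_field poly"
  assumes K: "subfield_of K" and b: "b \<in> poly_over K" and deg: "Polynomial.degree b > 0"
    and sep: "\<And>t. poly (pderiv b) t \<noteq> 0"
    and F: "(\<lambda>P. fst (F P)) \<in> polyfun2 K" "(\<lambda>P. snd (F P)) \<in> polyfun2 K"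
    and lc: "locally_constant_on Z1 (regular_funs K B) h1"
    and h: "\<And>t w u. ((poly b t, w), u) \<in> Z2 \<Longrightarrow>
       (F (t, w), u) \<in> Z1 \<and> h2 ((poly b t, w), u) = h1 (F (t, w), u)"
  shows "locally_constant_on Z2 (regular_funs K B) h2"
  unfolding locally_constant_on_def
proof
  interpret subfield_of K by fact
  fix z assume z: "z \<in> Z2"
  obtain x w u where zE: "z = ((x, w), u)" by (metis surj_pair)
  obtain t where t: "poly b t = x" using poly_surj_alg_closed[OF deg] by blast
  have 1: "(F (t, w), u) \<in> Z1" "h2 z = h1 (F (t, w), u)" using h[of t w u] z by (auto simp: zE t)
  obtain G where G: "G \<in> regular_funs K B" "G (F (t, w), u) \<noteq> 0"
    "\<And>z'. z' \<in> Z1 \<Longrightarrow> G z' \<noteq> 0 \<Longrightarrow> h1 z' = h1 (F (t, w), u)"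
    using lc 1(1) unfolding locally_constant_on_def by blast
  obtain C where C: "\<And>j. j < Polynomial.degree b \<Longrightarrow> C j \<in> regular_funs K B"
    "\<And>t w u. G (F (t, w), u) = (\<Sum>j<Polynomial.degree b. C j ((poly b t, w), u) * t ^ j)"
    using regular_funs_expansion[OF b refl deg regular_funs_compose[OF G(1) F]] by auto
  \<comment> \<open>The expansion is nonzero at the lift \<open>t\<close>, so some coefficient is
    nonzero at \<open>z\<close>; this \<open>C j\<close> defines the neighbourhood sought.\<close>
  obtain j where j: "j < Polynomial.degree b" "C j z \<noteq> 0"
  proof (rule ccontr)
    assume "\<not> thesis"
    then have "\<And>j. j < Polynomial.degree b \<Longrightarrow> C j z = 0" using that by blast
    then show False using C(2)[of t w u] G(2) by (simp add: t zE)
  qed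
  show "\<exists>g\<in>regular_funs K B. g z \<noteq> 0 \<and> (\<forall>z'\<in>Z2. g z' \<noteq> 0 \<longrightarrow> h2 z' = h2 z)"
  proof (intro bexI[of _ "C j"] conjI ballI impI C j)
    fix z' assume z': "z' \<in> Z2" "C j z' \<noteq> 0"
    obtain x' w' u' where zE': "z' = ((x', w'), u')" by (metis surj_pair)
    \<comment> \<open>The coefficients at \<open>z'\<close> form a nonzero polynomial of degree
      below that of \<open>b\<close>. It has fewer roots than the fibre over \<open>x'\<close> has
      points, so some lift of \<open>z'\<close> is sent by \<open>F\<close> to a point where
      \<open>G\<close> is nonzero.\<close>
    define Q where "Q = (\<Sum>j<Polynomial.degree b. Polynomial.monom (C j z') j)"
    have "poly.coeff Q j \<noteq> 0" using j z'
      by (simp add: Q_def coeff_sum if_distrib cong: if_cong)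
    then have Q0: "Q \<noteq> 0" by auto
    have "Polynomial.degree Q < Polynomial.degree b"
      unfolding Q_def
      by (rule degree_sum_less[OF _ deg]) (auto intro: le_less_trans[OF degree_monom_le])
    then have "card {t. poly Q t = 0} < card {t. poly b t = x'}"
      using card_poly_roots_bound[OF Q0] card_fibre_separable[OF deg sep, of x'] by simp
    then have "\<not> {t. poly b t = x'} \<subseteq> {t. poly Q t = 0}"
      using card_mono[OF poly_roots_finite[OF Q0], of "{t. poly b t = x'}"] by (meson leD)
    then obtain t' where t': "poly b t' = x'" "poly Q t' \<noteq> 0" by blast
    have "poly Q t' = G (F (t', w'), u')"
      by (simp add: C(2) Q_def poly_sum poly_monom t' zE')
    moreover have "(F (t', w'), u') \<in> Z1" "h2 z' = h1 (F (t', w'), u')"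
      using h[of t' w' u'] z' by (auto simp: zE' t')
    ultimately show "h2 z' = h2 z" using t'(2) G(3)[of "(F (t', w'), u')"] 1(2) by simp
  qed
qed

section \<open>Isomorphisms of sheaves associated with coverings\<close>

text \<open>This lets \<open>restr\<close> pull fibre product points back along \<open>w\<close>;
  \<open>restrict\<close> restores the extensionality required in \<open>alg_points\<close>.\<close>

lemma alg_points_comp:
  assumes B: "is_alg K B" and C: "is_alg K C" and K: "subfield_of K"
    and w: "w \<in> alg_hom K B C" and u: "u \<in> alg_points K C"
  shows "restrict (u \<circ> w) (carrier (fst B)) \<in> alg_points K B"
    and "coord B (restrict (u \<circ> w) (carrier (fst B))) = coord C u"
proof -
  interpret subfield_of K by fact
  interpret B: cring "fst B" using B by (simp add: is_alg_def)
  have wh: "w \<in> ring_hom (fst B) (fst C)" "\<And>P. P \<in> poly_over K \<Longrightarrow> w (snd B P) = snd C P"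
    using w by (auto simp: alg_hom_def)
  have uh: "u \<in> ring_hom (fst C) ring_of_type_algebra" "\<And>c. c \<in> K \<Longrightarrow> u (snd C [:c:]) = c"
    using u by (auto simp: alg_points_def)
  have snd: "snd B P \<in> carrier (fst B)" if "P \<in> poly_over K" for P
    using B that unfolding is_alg_def ring_hom_def poly_ring_over_def by auto
  have "restrict (u \<circ> w) (carrier (fst B)) \<in> ring_hom (fst B) ring_of_type_algebra"
    using wh(1) uh(1) by (auto simp: ring_hom_def Pi_def)
  then show "restrict (u \<circ> w) (carrier (fst B)) \<in> alg_points K B"
    using uh wh snd[OF poly_over_const] poly_over_const by (auto simp: alg_points_def)
  show "coord B (restrict (u \<circ> w) (carrier (fst B))) = coord C u"
    using snd[OF poly_over_X] wh(2)[OF poly_over_X] by (simp add: coord_def)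
qed

lemma fibre_prod_comp:
  assumes "is_alg K B" "is_alg K C" "subfield_of K"
    and "w \<in> alg_hom K B C" and "(P, u) \<in> fibre_prod K Y \<pi> \<kappa> C"
  shows "(P, restrict (u \<circ> w) (carrier (fst B))) \<in> fibre_prod K Y \<pi> \<kappa> B"
  using assms alg_points_comp[OF assms(1-4)] by (auto simp: fibre_prod_def)

text \<open>The relation \<open>rel\<close> is a correspondence between two coverings that is compatible with the group
  actions up to elements on which the characters agree; an equivariant function on the first covering
  then takes the same value at all points related to a given point of the second.\<close>

locale covering_transport =
  fixes K :: "'k::alg_closed_field set"
    and Y1 :: "('k \<times> 'k) set" and \<pi>1 :: "'k \<times> 'k \<Rightarrow> 'x1" and G1 :: "'g1 set"
    and act1 :: "'k \<times> 'k \<Rightarrow> 'g1 \<Rightarrow> 'k \<times> 'k" and \<chi>1 :: "'g1 \<Rightarrow> 'E::field" and \<kappa>1 :: "'k \<Rightarrow> 'x1"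
    and Y2 :: "('k \<times> 'k) set" and \<pi>2 :: "'k \<times> 'k \<Rightarrow> 'x2" and G2 :: "'g2 set"
    and act2 :: "'k \<times> 'k \<Rightarrow> 'g2 \<Rightarrow> 'k \<times> 'k" and \<chi>2 :: "'g2 \<Rightarrow> 'E" and \<kappa>2 :: "'k \<Rightarrow> 'x2"
    and rel :: "'k \<times> 'k \<Rightarrow> 'k \<times> 'k \<Rightarrow> bool"
    and b :: "'k poly" and F :: "'k \<times> 'k \<Rightarrow> 'k \<times> 'k"
  assumes K: "subfield_of K"
    and b: "b \<in> poly_over K" "Polynomial.degree b > 0" "\<And>t. poly (pderiv b) t \<noteq> 0"
    and F: "(\<lambda>P. fst (F P)) \<in> polyfun2 K" "(\<lambda>P. snd (F P)) \<in> polyfun2 K"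
    and lift: "\<And>Z s t. Z \<in> Y2 \<Longrightarrow> \<pi>2 Z = \<kappa>2 s \<Longrightarrow> poly b t = fst Z \<Longrightarrow>
        F (t, snd Z) \<in> Y1 \<and> \<pi>1 (F (t, snd Z)) = \<kappa>1 s \<and> rel (F (t, snd Z)) Z"
    and move: "\<And>P P' Z Z' s. P \<in> Y1 \<Longrightarrow> P' \<in> Y1 \<Longrightarrow> Z \<in> Y2 \<Longrightarrow> Z' \<in> Y2 \<Longrightarrow>
        \<pi>1 P = \<kappa>1 s \<Longrightarrow> \<pi>1 P' = \<kappa>1 s \<Longrightarrow> \<pi>2 Z = \<kappa>2 s \<Longrightarrow> \<pi>2 Z' = \<kappa>2 s \<Longrightarrow>
        rel P Z \<Longrightarrow> rel P' Z' \<Longrightarrow> \<exists>g\<in>G1. \<exists>c\<in>G2. P' = act1 P g \<and> Z' = act2 Z c \<and> \<chi>1 g = \<chi>2 c"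
    and act: "\<And>Z c. Z \<in> Y2 \<Longrightarrow> c \<in> G2 \<Longrightarrow> act2 Z c \<in> Y2 \<and> \<pi>2 (act2 Z c) = \<pi>2 Z"
    and free: "\<And>Z c c'. c \<in> G2 \<Longrightarrow> c' \<in> G2 \<Longrightarrow> act2 Z c = act2 Z c' \<Longrightarrow> c = c'"
    and unit: "\<And>Z. Z \<in> Y2 \<Longrightarrow> \<exists>c\<in>G2. act2 Z c = Z \<and> \<chi>2 c = 1"
begin

abbreviation "fib1 \<equiv> fibre_prod K Y1 \<pi>1 \<kappa>1"
abbreviation "fib2 \<equiv> fibre_prod K Y2 \<pi>2 \<kappa>2"
abbreviation "sheaf1 \<equiv> assoc_sheaf K Y1 \<pi>1 G1 act1 \<chi>1 \<kappa>1"
abbreviation "sheaf2 \<equiv> assoc_sheaf K Y2 \<pi>2 G2 act2 \<chi>2 \<kappa>2"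

text \<open>The choice of root is harmless: by \<open>transport_eq\<close> a section takes the same
  value at every point related to \<open>Z\<close>.\<close>

definition partner :: "'k \<times> 'k \<Rightarrow> 'k \<times> 'k" where
  "partner Z = F (SOME t. poly b t = fst Z, snd Z)"

definition transport :: "'k alg \<Rightarrow> (('k \<times> 'k) \<times> (nat \<Rightarrow> 'k) \<Rightarrow> 'E) \<Rightarrow> ('k \<times> 'k) \<times> (nat \<Rightarrow> 'k) \<Rightarrow> 'E"
  where "transport B h = (\<lambda>(Z, u). if (Z, u) \<in> fib2 B then h (partner Z, u) else 0)"

lemma partner:
  assumes "(Z, u) \<in> fib2 B"
  shows "(partner Z, u) \<in> fib1 B" "rel (partner Z) Z"
proof -
  have "\<exists>t. poly b t = fst Z" using poly_surj_alg_closed[OF b(2)] by blast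
  then have "poly b (SOME t. poly b t = fst Z) = fst Z" by (rule someI_ex)
  from lift[OF _ _ this] assms show "(partner Z, u) \<in> fib1 B" "rel (partner Z) Z"
    by (auto simp: fibre_prod_def partner_def)
qed

text \<open>\<open>move\<close> with \<open>Z\<close> taken twice yields some \<open>c\<close>
  fixing \<open>Z\<close>. Freeness identifies it with the element from \<open>unit\<close>, so
  \<open>\<chi>2 c = 1\<close>, and the matching \<open>\<chi>1 g\<close> is 1 as well.\<close>

lemma transport_eq:
  assumes h: "h \<in> sections sheaf1 B" and P: "(P, u) \<in> fib1 B" and Z: "(Z, u) \<in> fib2 B"
    and rel: "rel P Z"
  shows "transport B h (Z, u) = h (P, u)"
proof -
  note p = partner[OF Z]
  obtain g c where gc: "g \<in> G1" "c \<in> G2" "partner Z = act1 P g" "Z = act2 Z c" "\<chi>1 g = \<chi>2 c"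
    using move[OF _ _ _ _ _ _ _ _ rel p(2)] P Z p(1) unfolding fibre_prod_def by blast
  have "Z \<in> Y2" using Z by (simp add: fibre_prod_def)
  then obtain c' where "c' \<in> G2" "act2 Z c' = Z" "\<chi>2 c' = 1" using unit by blast
  then have "\<chi>2 c = 1" using free[of c c' Z] gc by metis
  moreover have "h (act1 P g, u) = \<chi>1 g * h (P, u)"
    using h P gc(1) by (auto simp: assoc_sheaf_def)
  ultimately show ?thesis using Z gc by (simp add: transport_def)
qed

text \<open>Local constancy descends along the map given by \<open>b\<close>; equivariance comes
  from \<open>move\<close> applied to \<open>Z\<close> and its translate.\<close>

lemma transport_sections:
  assumes h: "h \<in> sections sheaf1 B"
  shows "transport B h \<in> sections sheaf2 B"
proof -
  have lc: "locally_constant_on (fib1 B) (regular_funs K B) h"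
    using h by (simp add: assoc_sheaf_def)
  have "(F (t, w), u) \<in> fib1 B \<and> transport B h ((poly b t, w), u) = h (F (t, w), u)"
    if Z: "((poly b t, w), u) \<in> fib2 B" for t w u
  proof -
    have "(F (t, w), u) \<in> fib1 B" "rel (F (t, w)) (poly b t, w)"
      using Z lift[of "(poly b t, w)" "coord B u" t] by (auto simp: fibre_prod_def)
    then show ?thesis using transport_eq[OF h _ Z] by blast
  qed
  then have "locally_constant_on (fib2 B) (regular_funs K B) (transport B h)"
    by (rule locally_constant_descent[OF K b F lc])
  moreover have "transport B h (act2 Z c, u) = \<chi>2 c * transport B h (Z, u)"
    if Z: "(Z, u) \<in> fib2 B" and c: "c \<in> G2" for Z u c
  proof -
    have Z': "(act2 Z c, u) \<in> fib2 B" using Z c act by (auto simp: fibre_prod_def)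
    note p = partner[OF Z] and p' = partner[OF Z']
    obtain g c' where gc: "g \<in> G1" "c' \<in> G2" "partner (act2 Z c) = act1 (partner Z) g"
        "act2 Z c = act2 Z c'" "\<chi>1 g = \<chi>2 c'"
      using move[OF _ _ _ _ _ _ _ _ p(2) p'(2)] Z Z' p(1) p'(1) unfolding fibre_prod_def by blast
    have "c' = c" using free[of c c' Z] gc c by metis
    moreover have "h (act1 (partner Z) g, u) = \<chi>1 g * h (partner Z, u)"
      using h p(1) gc(1) by (auto simp: assoc_sheaf_def)
    ultimately show ?thesis using Z Z' gc(3,5) by (simp add: transport_def)
  qed
  moreover have "transport B h z = 0" if "z \<notin> fib2 B" for z
    using that by (cases z) (simp add: transport_def)
  ultimately show ?thesis
    unfolding assoc_sheaf_def etale_presheaf.simps mem_Collect_eq by blast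
qed

text \<open>\<open>partner\<close> depends on the covering point alone and restriction changes the
  other component alone, so the two commute.\<close>

lemma transport_restr:
  assumes B: "is_alg K B" and C: "is_alg K C" and w: "w \<in> alg_hom K B C"
  shows "transport C (restr sheaf1 B C w h) = restr sheaf2 B C w (transport B h)"
proof (rule ext)
  fix z :: "('k \<times> 'k) \<times> (nat \<Rightarrow> 'k)"
  obtain Z u where z: "z = (Z, u)" by (cases z)
  show "transport C (restr sheaf1 B C w h) z = restr sheaf2 B C w (transport B h) z"
    using fibre_prod_comp[OF B C K w, of Z u] partner(1)[of Z u C]
    by (auto simp: z transport_def assoc_sheaf_def)
qed

end

text \<open>One relation, read in both directions, gives two transports. Each undoes the other
  because a point and its partner are related, so \<open>transport_eq\<close> evaluates the
  composite.\<close>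

lemma assoc_sheaf_isoI:
  assumes 12: "covering_transport K Y1 \<pi>1 G1 act1 \<chi>1 \<kappa>1 Y2 \<pi>2 G2 act2 \<chi>2 \<kappa>2 rel b F"
    and 21: "covering_transport K Y2 \<pi>2 G2 act2 \<chi>2 \<kappa>2 Y1 \<pi>1 G1 act1 \<chi>1 \<kappa>1 (\<lambda>Z P. rel P Z) b' F'"
  shows "sheaf_iso (K :: 'a::alg_closed_field set) (assoc_sheaf K Y1 \<pi>1 G1 act1 \<chi>1 \<kappa>1) (assoc_sheaf K Y2 \<pi>2 G2 act2 \<chi>2 \<kappa>2)"
proof -
  interpret T: covering_transport K Y1 \<pi>1 G1 act1 \<chi>1 \<kappa>1 Y2 \<pi>2 G2 act2 \<chi>2 \<kappa>2 rel b F by (rule 12)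
  interpret T': covering_transport K Y2 \<pi>2 G2 act2 \<chi>2 \<kappa>2 Y1 \<pi>1 G1 act1 \<chi>1 \<kappa>1 "\<lambda>Z P. rel P Z" b' F'
    by (rule 21)
  have inv1: "T'.transport B (T.transport B h) = h" if h: "h \<in> sections T.sheaf1 B" for B h
  proof (rule ext)
    fix z :: "('a \<times> 'a) \<times> (nat \<Rightarrow> 'a)"
    obtain P u where z: "z = (P, u)" by (cases z)
    show "T'.transport B (T.transport B h) z = h z"
    proof (cases "z \<in> T.fib1 B")
      case True
      then show ?thesis
        using T.transport_eq[OF h] T'.partner[of P u B] by (simp add: z T'.transport_def)
    next
      case False
      then have "h z = 0" using h by (cases P) (simp add: assoc_sheaf_def z)
      then show ?thesis using False by (simp add: z T'.transport_def)
    qed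
  qed
  have inv2: "T.transport B (T'.transport B h) = h" if h: "h \<in> sections T.sheaf2 B" for B h
  proof (rule ext)
    fix z :: "('a \<times> 'a) \<times> (nat \<Rightarrow> 'a)"
    obtain Z u where z: "z = (Z, u)" by (cases z)
    show "T.transport B (T'.transport B h) z = h z"
    proof (cases "z \<in> T.fib2 B")
      case True
      then show ?thesis
        using T'.transport_eq[OF h] T.partner[of Z u B] by (simp add: z T.transport_def)
    next
      case False
      then have "h z = 0" using h by (cases Z) (simp add: assoc_sheaf_def z)
      then show ?thesis using False by (simp add: z T.transport_def)
    qed
  qed
  show ?thesis unfolding sheaf_iso_def
  proof (intro exI[of _ T.transport] conjI ballI allI)
    fix B :: "'a alg" and h h' c
    show "bij_betw (T.transport B) (sections T.sheaf1 B) (sections T.sheaf2 B)"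
      by (rule bij_betw_byWitness[where f' = "T'.transport B"])
         (simp_all add: inv1 inv2 T.transport_sections T'.transport_sections image_subset_iff)
    show "T.transport B (\<lambda>z. h z + h' z) = (\<lambda>z. T.transport B h z + T.transport B h' z)"
      by (simp add: T.transport_def fun_eq_iff)
    show "T.transport B (\<lambda>z. c * h z) = (\<lambda>z. c * T.transport B h z)"
      by (simp add: T.transport_def fun_eq_iff)
  next
    fix B C :: "'a alg" and w h
    assume "B \<in> etale_algs K" "C \<in> etale_algs K" "w \<in> alg_hom K B C"
    then show "T.transport C (restr T.sheaf1 B C w h) = restr T.sheaf2 B C w (T.transport B h)"
      by (intro T.transport_restr) (simp_all add: etale_algs_def)
  qed
qed

section \<open>Characteristic 2 and the Heisenberg group\<close>

lemma dual_mult: "\<chi> \<in> dual G \<Longrightarrow> x \<in> carrier G \<Longrightarrow> y \<in> carrier G \<Longrightarrow> \<chi> (x \<otimes>\<^bsub>G\<^esub> y) = \<chi> x * \<chi> y"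
  by (simp add: dual_def hom_def units_of_def ring_of_type_algebra_def)

lemma dual_nonzero: "\<chi> \<in> dual G \<Longrightarrow> x \<in> carrier G \<Longrightarrow> \<chi> x \<noteq> 0"
  by (auto simp: dual_def hom_def units_of_def ring_of_type_algebra_def Units_def Pi_def)

text \<open>A nonzero field element equal to its square is 1. This gives the value of a character at
  a neutral element.\<close>

lemma dual_idempotent:
  "\<chi> \<in> dual G \<Longrightarrow> x \<in> carrier G \<Longrightarrow> x \<otimes>\<^bsub>G\<^esub> x = x \<Longrightarrow> \<chi> x = 1"
  using dual_mult[of \<chi> G x x] dual_nonzero[of \<chi> G x] by simp

section \<open>Frobenius and traces in characteristic 2\<close>

locale char_2 =
  fixes m p :: nat and kty :: "'k::field itself"
  assumes CHAR: "CHAR('k) = 2" and m: "m \<ge> 1" and p: "p = 2 ^ m"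
begin

lemma add_self: "x + x = (0 :: 'k)"
  by (metis CHAR minus_CHAR_2 diff_self)

lemma add_self_left: "x + (x + y) = (y :: 'k)"
  by (simp add: add_self flip: add.assoc)

lemma uminus_eq: "- x = (x :: 'k)"
  by (rule uminus_CHAR_2[OF CHAR])

lemma minus_eq: "x - y = x + (y :: 'k)"
  by (rule minus_CHAR_2[OF CHAR])

lemma two_eq: "(2 :: 'k) = 0"
  using add_self[of 1] by simp

lemmas char2 = two_eq add_self add_self_left uminus_eq minus_eq

lemma eq_iff: "x = y \<longleftrightarrow> x + y = (0 :: 'k)"
  by (metis add_self add_self_left add.right_neutral)

lemma prime_CHAR: "Factorial_Ring.prime CHAR('k)" by (simp add: CHAR)

lemma p_power: "p ^ i = CHAR('k) ^ (m * i)"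
  by (simp add: p CHAR power_mult)

lemma frob_add: "(x + y :: 'k) ^ (p ^ i) = x ^ (p ^ i) + y ^ (p ^ i)"
  by (rule freshmans_dream'[OF prime_CHAR p_power])

lemma frob_add_1: "(x + y :: 'k) ^ p = x ^ p + y ^ p"
  using frob_add[of x y 1] by simp

lemma square_add: "(x + y :: 'k) ^ 2 = x ^ 2 + y ^ 2"
  by (simp add: power2_eq_square algebra_simps char2)

lemma frob_sum: "(sum g I :: 'k) ^ (p ^ i) = (\<Sum>j\<in>I. g j ^ (p ^ i))"
  by (rule freshmans_dream_sum'[OF prime_CHAR p_power])

lemma p_ge_2: "p \<ge> 2"
  using m power_increasing[of 1 m "2::nat"] by (simp add: p)

lemma frob_0: "(0 :: 'k) ^ (p ^ i) = 0"
  using p_ge_2 by (simp add: power_0_left)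

lemma frob_inj: "(x :: 'k) ^ p = y ^ p \<Longrightarrow> x = y"
  using p_ge_2 by (simp add: eq_iff[of x] eq_iff[of "x ^ p"] flip: frob_add_1)

lemma GF_subfield: "subfield_of (GF (p ^ i) :: 'k set)"
proof
  fix x y :: 'k
  show "x \<in> GF (p ^ i) \<Longrightarrow> y \<in> GF (p ^ i) \<Longrightarrow> x + y \<in> GF (p ^ i)"
    by (simp add: GF_def frob_add)
qed (simp_all add: GF_def frob_0 power_mult_distrib uminus_eq power_inverse)

lemma GF_p_subfield: "subfield_of (GF p :: 'k set)"
  using GF_subfield[of 1] by simp

lemma linearized_add:
  "P \<in> linearized p q \<Longrightarrow> poly P (x + y :: 'k) = poly P x + poly P y"
  by (auto simp: linearized_def poly_sum poly_monom frob_add distrib_left sum.distrib)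

lemma linearized_zero: "P \<in> linearized p q \<Longrightarrow> poly P (0 :: 'k) = 0"
  using linearized_add[of P q 0 0] by (simp only: add_self add_0_left)

lemma linearized_poly_over: "P \<in> linearized p (p ^ i) \<Longrightarrow> (P :: 'k poly) \<in> poly_over (GF (p ^ i))"
proof -
  interpret subfield_of "GF (p ^ i) :: 'k set" by (rule GF_subfield)
  show "P \<in> linearized p (p ^ i) \<Longrightarrow> P \<in> poly_over (GF (p ^ i))"
    by (auto simp: linearized_def intro!: poly_over_sum poly_over_monom)
qed

lemma ftrace_add: "ftrace p n (x + y :: 'k) = ftrace p n x + ftrace p n y"
  by (simp add: ftrace_def frob_add sum.distrib)

text \<open>The Frobenius shifts the summands by one place, so the sum telescopes to its two end
  terms.\<close>

lemma ftrace_frob: "ftrace p n (x :: 'k) ^ p + ftrace p n x = x ^ (p ^ n) + x"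
proof (induction n)
  case 0
  then show ?case using frob_0[of 1] by (simp add: ftrace_def char2)
next
  case (Suc n)
  have "ftrace p (Suc n) x ^ p + ftrace p (Suc n) x
      = (ftrace p n x ^ p + ftrace p n x) + (x ^ (p ^ n)) ^ p + x ^ (p ^ n)"
    by (simp add: ftrace_def frob_add_1 add_ac)
  also have "\<dots> = (x ^ (p ^ n) + x) + (x ^ (p ^ n)) ^ p + x ^ (p ^ n)" by (simp only: Suc)
  also have "\<dots> = x ^ (p ^ Suc n) + x" by (simp add: char2 add_ac mult.commute flip: power_mult)
  finally show ?case .
qed

end

section \<open>The Heisenberg group and its bi-additive form\<close>

locale heisenberg = char_2 m p kty for m p and kty :: "'k::field itself" +
  fixes e :: nat and a :: "nat \<Rightarrow> 'k"
begin

abbreviation "R \<equiv> poly (lin_poly p e a)"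
abbreviation "f \<equiv> f_fun p e a"
abbreviation "H \<equiv> heis p e a"

lemma R_eq: "R x = (\<Sum>i\<le>e. a i * x ^ (p ^ i))"
  by (simp add: lin_poly_def poly_sum poly_monom)

lemma R_add: "R (x + y) = R x + R y"
  by (simp add: R_eq frob_add distrib_left sum.distrib)

lemma E_add: "E_fun p e a (x + y) = E_fun p e a x + E_fun p e a y"
  by (simp add: E_fun_def R_add frob_add distrib_left sum.distrib add_ac)

text \<open>Signs vanish in characteristic 2, and the sums group into truncated traces, to which
  \<open>ftrace_frob\<close> applies.\<close>

lemma f_eq: "f x y = (\<Sum>i<e. ftrace p (e - i) (a i * x ^ (p ^ i) * y)) + ftrace p e (x * R y)"
  by (simp add: f_fun_def ftrace_def sum.distrib uminus_eq)

lemma f_add_left: "f (x + x') y = f x y + f x' y"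
  by (simp add: f_eq frob_add distrib_left distrib_right ftrace_add sum.distrib add_ac)

lemma f_add_right: "f x (y + y') = f x y + f x y'"
  by (simp add: f_eq R_add distrib_left distrib_right ftrace_add sum.distrib add_ac)

lemma f_zero: "f 0 y = 0" "f x 0 = 0"
  using f_add_left[of 0 0 y] f_add_right[of x 0 0] by (simp_all add: char2)

text \<open>Each trace leaves its two end terms. The equation \<open>E_fun p e a y = 0\<close>
  rewrites \<open>(x * R y) ^ (p ^ e)\<close> as a sum whose higher powers cancel against those of
  the other traces.\<close>

lemma f_frob:
  assumes "E_fun p e a y = 0"
  shows "f x y ^ p + f x y = x * R y + y * R x"
proof -
  define c where "c = (\<lambda>i. a i * x ^ (p ^ i) * y)"
  have "R y ^ (p ^ e) = (\<Sum>i\<le>e. (a i * y) ^ (p ^ (e - i)))"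
    using assms by (simp add: E_fun_def eq_iff[of "R y ^ (p ^ e)"])
  then have "(x * R y) ^ (p ^ e) = (\<Sum>i\<le>e. x ^ (p ^ e) * (a i * y) ^ (p ^ (e - i)))"
    by (simp add: power_mult_distrib sum_distrib_left)
  also have "\<dots> = (\<Sum>i\<le>e. c i ^ (p ^ (e - i)))"
  proof (intro sum.cong refl)
    fix i assume "i \<in> {..e}"
    then have "p ^ e = p ^ i * p ^ (e - i)" by (simp flip: power_add)
    then have "x ^ (p ^ e) = (x ^ (p ^ i)) ^ (p ^ (e - i))" by (simp add: power_mult)
    then show "x ^ (p ^ e) * (a i * y) ^ (p ^ (e - i)) = c i ^ (p ^ (e - i))"
      by (simp add: c_def power_mult_distrib mult_ac)
  qed
  \<comment> \<open>The term for \<open>i = e\<close> is \<open>c e\<close> itself; it completes the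
    sum for \<open>y * R x\<close>.\<close>
  also have "\<dots> = (\<Sum>i<e. c i ^ (p ^ (e - i))) + c e"
    by (simp add: lessThan_Suc_atMost[symmetric])
  finally have 1: "(x * R y) ^ (p ^ e) = (\<Sum>i<e. c i ^ (p ^ (e - i))) + c e" .
  have 2: "y * R x = (\<Sum>i<e. c i) + c e"
    by (simp add: R_eq c_def distrib_left sum_distrib_left mult_ac lessThan_Suc_atMost[symmetric])
  have "f x y ^ p + f x y
      = (\<Sum>i<e. ftrace p (e - i) (c i) ^ p + ftrace p (e - i) (c i))
        + (ftrace p e (x * R y) ^ p + ftrace p e (x * R y))"
    using frob_sum[of _ "{..<e}" 1] by (simp add: f_eq frob_add_1 sum.distrib c_def add_ac)
  also have "\<dots> = (\<Sum>i<e. c i ^ (p ^ (e - i))) + (\<Sum>i<e. c i) + ((x * R y) ^ (p ^ e) + x * R y)"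
    by (simp only: ftrace_frob sum.distrib)
  finally show ?thesis by (simp add: 1 2 add_ac char2)
qed

lemma carrier_iff: "(x, b) \<in> carrier H \<longleftrightarrow> E_fun p e a x = 0 \<and> b ^ p + b = x * R x"
  by (simp add: heis_def minus_eq)

lemma curve_iff: "(x, y) \<in> C_curve p e a \<longleftrightarrow> y ^ p + y = x * R x"
  by (simp add: C_curve_def minus_eq)

lemma mult_eq: "(x, b) \<otimes>\<^bsub>H\<^esub> (x', b') = (x + x', b + b' + f x x')"
  by (simp add: heis_def heis_act_def)

lemma one_eq: "\<one>\<^bsub>H\<^esub> = (0, 0)"
  by (simp add: heis_def)

text \<open>The cross terms of \<open>(x + x') * R (x + x')\<close> are exactly what
  \<open>f_frob\<close> contributes.\<close>

lemma act_curve: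
  assumes "P \<in> C_curve p e a" "g \<in> carrier H"
  shows "heis_act p e a P g \<in> C_curve p e a"
proof -
  obtain x y x' b where P: "P = (x, y)" "g = (x', b)" by (metis surj_pair)
  have "y ^ p + y = x * R x" "b ^ p + b = x' * R x'" "E_fun p e a x' = 0"
    using assms by (simp_all add: P curve_iff carrier_iff)
  note eqs = this(1,2) f_frob[OF this(3)]
  have "(y + b + f x x') ^ p + (y + b + f x x')
      = (y ^ p + y) + (b ^ p + b) + (f x x' ^ p + f x x')"
    by (simp add: frob_add_1 add_ac)
  also have "\<dots> = (x + x') * R (x + x')"
    by (simp only: eqs) (simp add: R_add algebra_simps)
  finally have "(y + b + f x x') ^ p + (y + b + f x x') = (x + x') * R (x + x')" .
  then show ?thesis by (simp add: P heis_act_def curve_iff)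
qed

lemma group_heis: "group H"
proof (rule groupI)
  show "\<one>\<^bsub>H\<^esub> \<in> carrier H"
    using E_add[of 0 0] frob_0[of 1] by (simp add: one_eq carrier_iff char2)
next
  fix g h assume gh: "g \<in> carrier H" "h \<in> carrier H"
  \<comment> \<open>The group law is the action formula, and elements of \<open>H\<close> are
    themselves points of the curve.\<close>
  then have "heis_act p e a g h \<in> C_curve p e a"
    by (intro act_curve) (auto simp: heis_def C_curve_def)
  then show "g \<otimes>\<^bsub>H\<^esub> h \<in> carrier H"
    using gh by (auto simp: heis_def C_curve_def heis_act_def E_add)
next
  fix g assume g: "g \<in> carrier H"
  obtain x b where gE: "g = (x, b)" by (cases g)
  \<comment> \<open>With equal arguments the right side of \<open>f_frob\<close> is doubled and
    vanishes, so the candidate inverse \<open>(x, b + f x x)\<close> still satisfies the curve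
    equation.\<close>
  have "f x x ^ p + f x x = 0" using g f_frob[of x x] by (simp add: gE carrier_iff char2)
  moreover have "(b + f x x) ^ p + (b + f x x) = b ^ p + b + (f x x ^ p + f x x)"
    by (simp add: frob_add_1 add_ac)
  ultimately have "(b + f x x) ^ p + (b + f x x) = b ^ p + b" by simp
  then have "(x, b + f x x) \<in> carrier H" using g by (simp only: gE carrier_iff)
  moreover have "(x, b + f x x) \<otimes>\<^bsub>H\<^esub> g = \<one>\<^bsub>H\<^esub>"
    by (simp add: gE mult_eq one_eq char2 add_ac)
  ultimately show "\<exists>h\<in>carrier H. h \<otimes>\<^bsub>H\<^esub> g = \<one>\<^bsub>H\<^esub>" by blast
qed (auto simp: mult_eq one_eq f_add_left f_add_right f_zero add_ac)

lemma inv_eq: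
  assumes "(x, b) \<in> carrier H"
  shows "inv\<^bsub>H\<^esub> (x, b) = (x, b + f x x)"
proof -
  interpret H: group H by (rule group_heis)
  obtain x' b' where i: "inv\<^bsub>H\<^esub> (x, b) = (x', b')" by (metis surj_pair)
  have "(x, b) \<otimes>\<^bsub>H\<^esub> (x', b') = (0, 0)" using H.r_inv[OF assms] by (simp add: i one_eq)
  then have "x' = x" "b' = b + f x x'"
    by (simp_all add: mult_eq eq_iff[of x'] eq_iff[of b'] add_ac)
  then show ?thesis by (simp add: i)
qed

text \<open>A maximal abelian subgroup contains the centre, and therefore whole fibres of the projection.\<close>

lemma maximal_abelian_fibre:
  assumes A: "maximal_abelian_subgroup A H" and xb: "(x, b) \<in> A" and c: "(x, b') \<in> carrier H"
  shows "(x, b') \<in> A"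
proof -
  interpret H: group H by (rule group_heis)
  interpret F: subfield_of "GF p :: 'k set" by (rule GF_p_subfield)
  have sub: "subgroup A H" and comm: "\<And>g h. g \<in> A \<Longrightarrow> h \<in> A \<Longrightarrow> g \<otimes>\<^bsub>H\<^esub> h = h \<otimes>\<^bsub>H\<^esub> g"
    using A by (auto simp: maximal_abelian_subgroup_def abelian_subgroup_def)
  interpret A: subgroup A H by (rule sub)
  \<comment> \<open>\<open>B\<close> is the product of \<open>A\<close> with the central elements
    \<open>(0, c)\<close>. It is again abelian, so maximality gives \<open>B = A\<close>.\<close>
  define B where "B = {(x, b + c) | x b c. (x, b) \<in> A \<and> c \<in> GF p}"
  have GF: "c ^ p = c" if "c \<in> GF p" for c :: 'k using that by (simp add: GF_def)
  have BI: "(x, b + c) \<in> B" if "(x, b) \<in> A" "c \<in> GF p" for x b c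
    using that by (auto simp: B_def)
  have AB: "A \<subseteq> B" using BI[OF _ F.zero] by auto
  have inH: "(x, b + c) \<in> carrier H" if "(x, b) \<in> A" "c \<in> GF p" for x b c
  proof -
    have "(b + c) ^ p + (b + c) = b ^ p + b + (c + c)"
      using GF[OF that(2)] by (simp only: frob_add_1 add_ac)
    then show ?thesis using A.mem_carrier[OF that(1)] by (simp only: carrier_iff add_self add_0_right)
  qed
  have "subgroup B H"
  proof (rule H.subgroupI)
    show "B \<subseteq> carrier H" using inH by (auto simp: B_def)
    show "B \<noteq> {}" using AB xb by auto
  next
    fix g assume "g \<in> B"
    then obtain x b c where g: "g = (x, b + c)" "(x, b) \<in> A" "c \<in> GF p" by (auto simp: B_def)
    have "(x, b + f x x) \<in> A"
      using A.m_inv_closed[OF g(2)] inv_eq[OF A.mem_carrier[OF g(2)]] by simp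
    then have "(x, (b + f x x) + c) \<in> B" using g(3) BI by blast
    then show "inv\<^bsub>H\<^esub> g \<in> B" using inv_eq[OF inH[OF g(2,3)]] by (simp add: g add_ac)
  next
    fix g g' assume "g \<in> B" "g' \<in> B"
    then obtain x b c x' b' c' where g: "g = (x, b + c)" "(x, b) \<in> A" "c \<in> GF p"
      "g' = (x', b' + c')" "(x', b') \<in> A" "c' \<in> GF p" by (auto simp: B_def)
    have "(x + x', b + b' + f x x') \<in> A" using A.m_closed[OF g(2,5)] by (simp add: mult_eq)
    then have "(x + x', (b + b' + f x x') + (c + c')) \<in> B" using BI F.add g by blast
    then show "g \<otimes>\<^bsub>H\<^esub> g' \<in> B" by (simp add: g mult_eq add_ac)
  qed
  moreover have "g \<otimes>\<^bsub>H\<^esub> g' = g' \<otimes>\<^bsub>H\<^esub> g" if gB: "g \<in> B" "g' \<in> B" for g g'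
  proof -
    obtain x b c x' b' c' where g: "g = (x, b + c)" "(x, b) \<in> A" "c \<in> GF p"
      "g' = (x', b' + c')" "(x', b') \<in> A" "c' \<in> GF p" using gB by (auto simp: B_def)
    have "f x x' = f x' x" using comm[OF g(2,5)] by (simp add: mult_eq add_ac)
    then show ?thesis by (simp add: g mult_eq add_ac)
  qed
  ultimately have "B = A"
    using A AB by (simp add: maximal_abelian_subgroup_def abelian_subgroup_def)
  \<comment> \<open>Second coordinates over the same \<open>x\<close> solve the same equation, so
    their difference is fixed by the \<open>p\<close>-th power map.\<close>
  moreover have "b + b' \<in> GF p"
  proof -
    have "b ^ p + b = b' ^ p + b'" using A.mem_carrier[OF xb] c by (simp add: carrier_iff)
    moreover have "(b + b') ^ p + (b + b') = (b ^ p + b) + (b' ^ p + b')"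
      by (simp add: frob_add_1 add_ac)
    ultimately have "(b + b') ^ p + (b + b') = 0" by (simp only: add_self)
    then show ?thesis by (simp add: GF_def flip: eq_iff)
  qed
  ultimately show ?thesis using BI[OF xb, of "b + b'"] by (simp add: char2)
qed

end

section \<open>The two coverings and the correspondence between them\<close>

locale char_2_closed = char_2 m p kty for m p and kty :: "'k::alg_closed_field itself"
begin

text \<open>Existence comes from algebraic closedness and uniqueness from \<open>frob_inj\<close>;
  together they justify the \<open>THE\<close> in \<open>proot\<close>.\<close>

lemma proot: "proot p (c :: 'k) ^ p = c"
proof -
  obtain v :: 'k where v: "v ^ p = c" using nth_root_exists[of p c] p_ge_2 by auto
  have "proot p c = v"
    unfolding proot_def
  proof (rule the_equality)
    show "u = v" if "u ^ p = c" for u using that v by (simp add: frob_inj)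
  qed (rule v)
  then show ?thesis by (simp add: v)
qed

lemma proot_GF: "(c :: 'k) \<in> GF q \<Longrightarrow> proot p c \<in> GF q"
proof -
  assume c: "c \<in> GF q"
  have "(proot p c ^ q) ^ p = (proot p c ^ p) ^ q" by (simp flip: power_mult add: mult.commute)
  also have "\<dots> = proot p c ^ p" using c by (simp add: proot GF_def)
  finally show ?thesis by (simp add: GF_def frob_inj)
qed

text \<open>As \<open>n > 0\<close> makes \<open>p ^ n\<close> even, the left side has derivative 1.
  By the chain rule \<open>pderiv b\<close> then divides 1.\<close>

lemma separable_of_pcompose:
  fixes b P :: "'k poly"
  assumes "Polynomial.monom 1 (p ^ n) + [:0, 1:] = pcompose P b" "n > 0"
  shows "poly (pderiv b) t \<noteq> 0" "Polynomial.degree b > 0"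
proof -
  have "pderiv (Polynomial.monom 1 (p ^ n) + [:0, 1:] :: 'k poly) = 1"
  proof -
    have "even (p ^ n)" using m assms(2) by (simp add: p)
    then have "of_nat (p ^ n) = (0 :: 'k)" by (auto elim!: evenE simp: two_eq)
    then show ?thesis by (simp add: pderiv_add pderiv_pCons pderiv_monom one_pCons)
  qed
  then have 1: "pcompose (pderiv P) b * pderiv b = 1" by (simp add: assms(1) pderiv_pcompose)
  then have "poly (pcompose (pderiv P) b) t * poly (pderiv b) t = 1"
    by (metis poly_mult poly_1)
  then show "poly (pderiv b) t \<noteq> 0" by auto
  show "Polynomial.degree b > 0"
  proof (rule ccontr)
    assume "\<not> Polynomial.degree b > 0"
    then obtain c where "b = [:c:]" using degree_eq_zeroE by blast
    then show False using 1 by (simp add: pderiv_pCons)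
  qed
qed

lemma inv_witt2: "inv\<^bsub>witt2 UNIV\<^esub> (z, w :: 'k) = (z, w + z ^ 2)"
proof -
  have "group (witt2 (UNIV :: 'k set))"
  proof (rule groupI)
    fix x :: "'k \<times> 'k"
    show "\<exists>y\<in>carrier (witt2 UNIV). y \<otimes>\<^bsub>witt2 UNIV\<^esub> x = \<one>\<^bsub>witt2 UNIV\<^esub>"
      by (cases x, rule bexI[of _ "(fst x, snd x + fst x ^ 2)"])
         (auto simp: witt2_def witt_add_def char2 power2_eq_square add_ac)
  qed (auto simp: witt2_def witt_add_def algebra_simps)
  then interpret group "witt2 (UNIV :: 'k set)" .
  show ?thesis
    by (rule inv_equality)
       (auto simp: witt2_def witt_add_def char2 power2_eq_square add_ac)
qed

text \<open>The term \<open>z ^ 2\<close> comes from the Witt inverse, and \<open>z ^ p * z\<close>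
  is the carry in \<open>witt_add\<close>.\<close>

lemma lang_eq: "lang p (z, w :: 'k) = (z ^ p + z, w ^ p + w + z ^ 2 + z ^ p * z)"
  by (simp add: lang_def inv_witt2 witt_add_def add_ac)

text \<open>The Frobenius fixes \<open>c\<close>, so translation by \<open>c\<close> cancels in the
  Witt difference; this is checked on coordinates.\<close>

lemma lang_witt_add:
  assumes "c \<in> GF p \<times> GF p"
  shows "lang p (witt_add Z c) = lang p (Z :: 'k \<times> 'k)"
proof -
  obtain z w c1 c2 where Z: "Z = (z, w)" "c = (c1, c2)" by (metis surj_pair)
  have "c1 ^ p = c1" "c2 ^ p = c2" using assms by (auto simp: Z GF_def)
  then show ?thesis
    by (simp add: Z lang_eq witt_add_def frob_add_1 power_mult_distrib square_add algebra_simps char2)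
       (simp add: power2_eq_square char2)
qed

end

section \<open>The covering data attached to \<open>A\<close>\<close>

locale heis_data = heisenberg m p kty e a + char_2_closed m p kty
  for m p and kty :: "'k::alg_closed_field itself" and e and a :: "nat \<Rightarrow> 'k" +
  fixes n :: nat and A :: "('k \<times> 'k) set" and fU \<Delta> ax :: "'k poly" and s0 \<alpha> \<beta> :: 'k
    and r :: "'k \<Rightarrow> 'k" and \<psi> :: "'k \<Rightarrow> 'E::field" and \<xi> \<xi>W :: "'k \<times> 'k \<Rightarrow> 'E" and \<xi>U :: "'k \<Rightarrow> 'E"
    and U :: "'k set"
  assumes n: "n \<ge> 1"
    and A_max: "maximal_abelian_subgroup A (heis p e a)"
    and fU: "fU \<in> linearized p (p ^ n)"
    and Abar: "fst ` A = Ker (fU ^ p + fU)"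
    and \<Delta>: "\<Delta> \<in> poly_over (GF (p ^ n))" "poly \<Delta> 0 = 0"
      "\<Delta> ^ p + \<Delta> = [:0, 1:] * lin_poly p e a + fU * pcompose (Polynomial.monom 1 p + [:0, s0:]) fU"
    and \<alpha>: "\<alpha> \<in> GF (p ^ n)" "proot p \<alpha> + \<alpha> = s0 + 1"
    and r_add: "\<And>x y. x \<in> fst ` A \<Longrightarrow> y \<in> fst ` A \<Longrightarrow> r (x + y) = r x + r y"
    and \<psi>: "\<psi> \<in> dual (add_group_on (GF p))"
    and \<xi>: "\<xi> \<in> dual ((heis p e a)\<lparr>carrier := A\<rparr>)" "\<And>c. c \<in> GF p \<Longrightarrow> \<xi> (0, c) = \<psi> c"
    and \<xi>W: "\<xi>W \<in> dual (witt2 (GF p))"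
    and \<xi>U: "\<xi>U \<in> dual (add_group_on U)" "0 \<in> U"
    and \<xi>_eq: "\<And>x y. (x, y) \<in> A \<Longrightarrow>
      \<xi> (x, y) = \<xi>W (poly fU x, y + poly \<Delta> x + proot p \<alpha> * poly fU x ^ 2) * \<xi>U (r x)"
    and ax: "ax \<in> linearized p (p ^ n)"
      "Polynomial.monom 1 (p ^ n) + [:0, 1:] = pcompose (fU ^ p + fU) ax"
    and \<beta>: "\<beta> \<in> GF (p ^ n)" "\<And>x. x \<in> GF (p ^ n) \<Longrightarrow> \<xi>U (r (poly ax x)) = \<psi> (ftrace p n (\<beta> * x))"
begin

sublocale Fq: subfield_of "GF (p ^ n) :: 'k set" by (rule GF_subfield)
sublocale Fp: subfield_of "GF p :: 'k set" by (rule GF_p_subfield)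

lemma A_subgroup: "subgroup A H"
  using A_max by (simp add: maximal_abelian_subgroup_def abelian_subgroup_def)

lemma A_carrier: "g \<in> A \<Longrightarrow> g \<in> carrier H"
  using A_subgroup by (rule subgroup.mem_carrier)

lemma in_fst_A: "d \<in> fst ` A \<longleftrightarrow> poly fU d ^ p + poly fU d = 0"
  by (simp add: Abar Ker_def)

lemma fU_GF: "d \<in> fst ` A \<Longrightarrow> poly fU d \<in> GF p"
  by (simp add: in_fst_A GF_def flip: eq_iff)

lemma fU_add: "poly fU (x + y) = poly fU x + poly fU y"
  by (rule linearized_add[OF fU])

lemma ax_add: "poly ax (x + y) = poly ax x + poly ax y"
  by (rule linearized_add[OF ax(1)])

lemma FA_ax: "poly fU (poly ax t) ^ p + poly fU (poly ax t) = t ^ (p ^ n) + t"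
  using arg_cong[OF ax(2), of "\<lambda>P. poly P t"] by (simp add: poly_monom poly_pcompose)

lemma Delta_eq:
  "poly \<Delta> x ^ p + poly \<Delta> x = x * R x + poly fU x * (poly fU x ^ p + s0 * poly fU x)"
  using arg_cong[OF \<Delta>(3), of "\<lambda>P. poly P x"]
  by (simp add: poly_monom poly_pcompose mult.commute)

text \<open>Both sides have the same image under \<open>u \<mapsto> u\<^sup>p + u\<close>, so they differ by a polynomial in \<open>x\<close> with
  values in the finite field \<open>GF p\<close>, which must be constant.\<close>

lemma Delta_add:
  assumes d: "d \<in> fst ` A"
  shows "f x d + poly \<Delta> (x + d) + poly \<Delta> x + poly \<Delta> d = poly fU x * poly fU d"
proof -
  define w where "w = poly fU d"
  have w: "w ^ p = w" using fU_GF[OF d] by (simp add: w_def GF_def)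
  have Ed: "E_fun p e a d = 0" using d A_carrier by (auto simp: carrier_iff)
  \<comment> \<open>\<open>Pf\<close> presents \<open>f y d\<close> as a polynomial in
    \<open>y\<close>, so that \<open>D\<close> is a polynomial and \<open>const_of_power_eq\<close>
    applies to it.\<close>
  define Pf where "Pf = (\<Sum>i<e. \<Sum>j<e - i. ([:a i * d:] * Polynomial.monom 1 (p ^ i)) ^ (p ^ j))
      + (\<Sum>j<e. [:0, R d:] ^ (p ^ j))"
  have Pf: "poly Pf y = f y d" for y
    by (simp add: Pf_def f_eq ftrace_def poly_sum poly_monom mult_ac)
  define D where "D = Pf + pcompose \<Delta> [:d, 1:] + \<Delta> + [:poly \<Delta> d:] + smult w fU"
  have D: "poly D y = f y d + poly \<Delta> (y + d) + poly \<Delta> y + poly \<Delta> d + poly fU y * w" for y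
    by (simp add: D_def Pf poly_pcompose add_ac mult_ac)
  have "poly D y ^ p = poly D y" for y
  proof -
    define z where "z = poly fU y"
    have "poly D y ^ p + poly D y = (f y d ^ p + f y d)
       + (poly \<Delta> (y + d) ^ p + poly \<Delta> (y + d)) + (poly \<Delta> y ^ p + poly \<Delta> y)
       + (poly \<Delta> d ^ p + poly \<Delta> d) + (z ^ p * w + z * w)"
      by (simp add: D frob_add_1 power_mult_distrib w z_def add_ac)
    also have "\<dots> = (y * R d + d * R y)
       + ((y + d) * (R y + R d) + (z + w) * (z ^ p + w + s0 * (z + w)))
       + (y * R y + z * (z ^ p + s0 * z)) + (d * R d + w * (w + s0 * w)) + (z ^ p * w + z * w)"
      by (simp only: f_frob[OF Ed] Delta_eq fU_add R_add frob_add_1 w z_def[symmetric] w_def[symmetric])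
    also have "\<dots> = 0" by (simp add: algebra_simps char2)
    finally show ?thesis by (simp add: eq_iff[of "poly D y ^ p"])
  qed
  then have "poly D x = poly D 0" by (rule const_of_power_eq[rotated]) (use p_ge_2 in simp)
  also have "\<dots> = 0"
    by (simp add: D f_zero \<Delta>(2) linearized_zero[OF fU] char2)
  finally show ?thesis unfolding D w_def by (rule iffD2[OF eq_iff])
qed

section \<open>The correspondence and its compatibility with the two characters\<close>

text \<open>The amount added to \<open>y\<close> on passing from the curve to the torsor. The trace
  accounts for \<open>\<beta> * s\<close>, the other two terms for
  \<open>\<alpha> * s ^ 2\<close>.\<close>

definition shift :: "'k \<Rightarrow> 'k" where
  "shift t = poly \<Delta> (poly ax t) + proot p \<alpha> * poly fU (poly ax t) ^ 2 + ftrace p n (\<beta> * t)"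

definition to_lang :: "'k \<times> 'k \<Rightarrow> 'k \<times> 'k" where
  "to_lang = (\<lambda>P. (poly fU (poly ax (fst P)), snd P + shift (fst P)))"

text \<open>The second component of the argument is now a torsor coordinate; in characteristic 2
  adding \<open>shift\<close> again removes it.\<close>

definition to_curve :: "'k \<times> 'k \<Rightarrow> 'k \<times> 'k" where
  "to_curve = (\<lambda>P. (poly ax (fst P), snd P + shift (fst P)))"

text \<open>The equations of curve and torsor are left out; \<open>rel_lang_iff\<close> shows that
  they are equivalent for related points.\<close>

definition rel :: "'k \<times> 'k \<Rightarrow> 'k \<times> 'k \<Rightarrow> bool" where
  "rel P Z \<longleftrightarrow> (\<exists>t. fst P = poly ax t \<and> Z = (poly fU (poly ax t), snd P + shift t))"

lemma polyfun2_shift: "g \<in> polyfun2 (GF (p ^ n)) \<Longrightarrow> (\<lambda>P. shift (g P)) \<in> polyfun2 (GF (p ^ n))"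
  unfolding shift_def ftrace_def
  by (intro Fq.polyfun2_add Fq.polyfun2_mult Fq.polyfun2_poly Fq.polyfun2_power Fq.polyfun2_sum
      Fq.polyfun2_const proot_GF \<alpha>(1) \<beta>(1) \<Delta>(1) linearized_poly_over fU ax(1))

lemma polyfun2_to_lang:
  "(\<lambda>P. fst (to_lang P)) \<in> polyfun2 (GF (p ^ n))" "(\<lambda>P. snd (to_lang P)) \<in> polyfun2 (GF (p ^ n))"
  unfolding to_lang_def fst_conv snd_conv
  by (intro Fq.polyfun2_add Fq.polyfun2_poly polyfun2_shift Fq.polyfun2_fst Fq.polyfun2_snd
      linearized_poly_over fU ax(1))+

lemma polyfun2_to_curve:
  "(\<lambda>P. fst (to_curve P)) \<in> polyfun2 (GF (p ^ n))" "(\<lambda>P. snd (to_curve P)) \<in> polyfun2 (GF (p ^ n))"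
  unfolding to_curve_def fst_conv snd_conv
  by (intro Fq.polyfun2_add Fq.polyfun2_poly polyfun2_shift Fq.polyfun2_fst Fq.polyfun2_snd
      linearized_poly_over ax(1))+

text \<open>The terms \<open>z ^ p * z\<close> cancel, and the coefficient of \<open>z ^ 2\<close>
  becomes \<open>s0 + \<alpha>' + 1 = \<alpha>\<close>. With \<open>\<alpha> * (z ^ p) ^ 2\<close>
  this gives \<open>\<alpha> * s ^ 2\<close>, which is what the condition on \<open>\<alpha>\<close>
  is made for.\<close>

lemma shift_frob:
  assumes z: "z = poly fU (poly ax t)" and s: "s = t ^ (p ^ n) + t"
  shows "shift t ^ p + shift t + z ^ 2 + z ^ p * z = poly ax t * R (poly ax t) + \<alpha> * s ^ 2 + \<beta> * s"
proof -
  define \<alpha>' where "\<alpha>' = proot p \<alpha>"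
  have \<alpha>': "\<alpha>' ^ p = \<alpha>" "s0 = \<alpha>' + \<alpha> + 1"
    using \<alpha>(2) proot by (auto simp: \<alpha>'_def char2)
  have \<beta>q: "\<beta> ^ (p ^ n) = \<beta>" using \<beta>(1) by (simp add: GF_def)
  have sz: "s = z ^ p + z" using FA_ax by (simp add: z s)
  define x where "x = poly ax t"
  have zx: "poly fU x = z" by (simp add: z x_def)
  have "(z ^ 2) ^ p = (z ^ p) ^ 2" by (simp add: mult.commute flip: power_mult)
  then have "shift t ^ p + shift t = (poly \<Delta> x ^ p + poly \<Delta> x) + (\<alpha> * (z ^ p) ^ 2 + \<alpha>' * z ^ 2)
      + (ftrace p n (\<beta> * t) ^ p + ftrace p n (\<beta> * t))"
    by (simp add: shift_def frob_add_1 power_mult_distrib \<alpha>'(1) zx add_ac flip: \<alpha>'_def x_def)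
  also have "\<dots> = (x * R x + z * (z ^ p + s0 * z)) + (\<alpha> * (z ^ p) ^ 2 + \<alpha>' * z ^ 2) + \<beta> * s"
    unfolding ftrace_frob Delta_eq
    by (simp add: power_mult_distrib \<beta>q s distrib_left zx flip: x_def)
  finally show ?thesis
    unfolding \<alpha>'(2) x_def[symmetric] sz square_add
    by (simp add: power2_eq_square algebra_simps char2)
qed

text \<open>The second Lang coordinate exceeds its target by \<open>y ^ p + y + x * R x\<close>, the
  defect in the curve equation.\<close>

lemma rel_lang_iff:
  assumes rel: "rel P Z"
  shows "P \<in> C_curve p e a \<and> poly (fU ^ p + fU) (fst P) = s \<longleftrightarrow> lang p Z = (s, \<alpha> * s ^ 2 + \<beta> * s)"
proof -
  obtain x y t where P: "P = (x, y)" "x = poly ax t" "Z = (poly fU x, y + shift t)"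
    using rel by (cases P) (auto simp: rel_def)
  define z where "z = poly fU x"
  define s' where "s' = t ^ (p ^ n) + t"
  have s': "z ^ p + z = s'" using FA_ax by (simp add: z_def s'_def P(2))
  have "snd (lang p Z) = (y ^ p + y) + (shift t ^ p + shift t + z ^ 2 + z ^ p * z)"
    by (simp add: P(3) lang_eq frob_add_1 add_ac flip: z_def)
  also have "\<dots> = (y ^ p + y + x * R x) + (\<alpha> * s' ^ 2 + \<beta> * s')"
    by (subst shift_frob[OF _ s'_def]) (simp_all add: z_def P(2) add_ac)
  finally have "lang p Z = (s', (y ^ p + y + x * R x) + (\<alpha> * s' ^ 2 + \<beta> * s'))"
    using s' by (simp add: P(3) lang_eq flip: z_def)
  then show ?thesis
    using s' by (auto simp: P(1) curve_iff eq_iff[of "y ^ p + y"] simp flip: z_def)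
qed

text \<open>\<open>(0, c)\<close> lies in \<open>A\<close> by maximality, and at
  \<open>x = 0\<close> the formula \<open>\<xi>_eq\<close> loses \<open>fU\<close>,
  \<open>\<Delta>\<close> and the factor \<open>\<xi>U (r 0) = 1\<close>.\<close>

lemma xi_W_psi: "c \<in> GF p \<Longrightarrow> \<xi>W (0, c) = \<psi> c"
proof -
  assume c: "c \<in> GF p"
  interpret H: group H by (rule group_heis)
  have "(0, 0) \<in> A" using subgroup.one_closed[OF A_subgroup] by (simp add: one_eq)
  moreover have "(0, c) \<in> carrier H"
    using c H.one_closed by (simp add: one_eq carrier_iff GF_def char2)
  ultimately have "(0, c) \<in> A" by (rule maximal_abelian_fibre[OF A_max])
  moreover from this have "0 \<in> fst ` A" by force
  then have "r 0 = 0" using r_add[of 0 0] by (simp only: add_self add_0_left)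
  moreover have "\<xi>U 0 = 1"
    by (rule dual_idempotent[OF \<xi>U(1)]) (simp_all add: add_group_on_def \<xi>U(2))
  moreover have "poly fU 0 = 0" by (rule linearized_zero[OF fU])
  ultimately show ?thesis using \<xi>(2)[OF c] \<xi>_eq[of 0 c] by (simp add: \<Delta>(2))
qed

text \<open>The difference \<open>\<tau>\<close> of the two parameters determines both group
  elements: \<open>g\<close> lies over \<open>d = poly ax \<tau>\<close>, and \<open>c\<close> is
  the Witt component attached to \<open>g\<close>, translated by \<open>(0, v)\<close> for the trace
  \<open>v\<close> of \<open>\<beta> * \<tau>\<close>. The choice of \<open>\<beta>\<close> makes
  the characters agree.\<close>

lemma rel_move:
  assumes P: "P \<in> C_curve p e a" "P' \<in> C_curve p e a"
    and s: "lang p Z = (s, u)" "lang p Z' = (s, u)"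
    and rel: "rel P Z" "rel P' Z'"
  shows "\<exists>g\<in>A. \<exists>c\<in>carrier (witt2 (GF p)). P' = heis_act p e a P g \<and> Z' = witt_add Z c \<and> \<xi> g = \<xi>W c"
proof -
  obtain x y t where P1: "P = (x, y)" "x = poly ax t" "Z = (poly fU x, y + shift t)"
    using rel(1) by (cases P) (auto simp: rel_def)
  obtain x' y' t' where P2: "P' = (x', y')" "x' = poly ax t'" "Z' = (poly fU x', y' + shift t')"
    using rel(2) by (cases P') (auto simp: rel_def)
  define \<tau> where "\<tau> = t + t'"
  define d where "d = poly ax \<tau>"
  have t': "t' = t + \<tau>" by (simp add: \<tau>_def char2)
  have x': "x' = x + d" by (simp add: P1 P2 d_def t' ax_add)
  \<comment> \<open>Equal first Lang coordinates make \<open>t\<close> and \<open>t'\<close> roots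
    of the same equation, so \<open>\<tau>\<close> lies in the field with \<open>p ^ n\<close>
    elements.\<close>
  have "t ^ (p ^ n) + t = s" "t' ^ (p ^ n) + t' = s"
    using s by (simp_all add: P1(3) P2(3) lang_eq) (simp_all add: P1(2) P2(2) FA_ax)
  then have \<tau>0: "\<tau> ^ (p ^ n) + \<tau> = 0"
    by (simp add: \<tau>_def frob_add) (metis add_self add.assoc add.commute)
  then have \<tau>: "\<tau> \<in> GF (p ^ n)" by (simp add: GF_def flip: eq_iff)
  have d: "d \<in> fst ` A" by (simp add: in_fst_A d_def FA_ax \<tau>0)
  \<comment> \<open>This value is forced by the requirement that \<open>(d, b)\<close> move
    \<open>P\<close> to \<open>P'\<close>.\<close>
  define b where "b = y' + y + f x d"
  have y': "y' = y + b + f x d" by (simp add: b_def add_ac char2)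
  \<comment> \<open>Some element of \<open>A\<close> lies over \<open>d\<close>;
    \<open>maximal_abelian_fibre\<close> will then put \<open>(d, b)\<close> in \<open>A\<close>
    too.\<close>
  obtain b0 where b0: "(d, b0) \<in> A" using d by auto
  have Ed: "E_fun p e a d = 0" using A_carrier[OF b0] by (simp add: carrier_iff)
  have "b ^ p + b = (y' ^ p + y') + (y ^ p + y) + (f x d ^ p + f x d)"
    by (simp add: b_def frob_add_1 add_ac)
  also have "\<dots> = x' * R x' + x * R x + (x * R d + d * R x)"
    using P by (simp only: P1(1) P2(1) curve_iff f_frob[OF Ed])
  also have "\<dots> = d * R d" by (simp add: x' R_add algebra_simps char2)
  finally have "(d, b) \<in> carrier H" using Ed by (simp only: carrier_iff)
  then have g: "(d, b) \<in> A" by (rule maximal_abelian_fibre[OF A_max b0])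
  define w where "w = poly fU d"
  define v where "v = ftrace p n (\<beta> * \<tau>)"
  \<comment> \<open>\<open>(w, c2)\<close> is the Witt vector at which \<open>\<xi>_eq\<close>
    evaluates \<open>\<xi>W\<close> for the element \<open>(d, b)\<close>.\<close>
  define c2 where "c2 = b + poly \<Delta> d + proot p \<alpha> * w ^ 2"
  have w: "w \<in> GF p" using fU_GF[OF d] by (simp add: w_def)
  have v: "v \<in> GF p"
  proof -
    have "v ^ p + v = \<beta> * (\<tau> ^ (p ^ n) + \<tau>)"
      using \<beta>(1) by (simp add: v_def ftrace_frob power_mult_distrib GF_def distrib_left)
    then show ?thesis by (simp add: \<tau>0 GF_def flip: eq_iff)
  qed
  have Zc: "Z' = witt_add Z (w, c2 + v)"
  proof -
    \<comment> \<open>By \<open>Delta_add\<close> the last bracket is \<open>poly fU x * w\<close>,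
      the carry of the Witt addition.\<close>
    have "y' + shift t' = y + shift t + (c2 + v)
      + (f x d + poly \<Delta> (x + d) + poly \<Delta> x + poly \<Delta> d)"
      unfolding shift_def P1(2)[symmetric] P2(2)[symmetric]
      by (simp add: t' distrib_left ftrace_add x' y' c2_def v_def w_def fU_add square_add
          add_ac char2)
    then show ?thesis
      by (simp add: P1(3) P2(3) Delta_add[OF d] witt_add_def x' fU_add w_def)
  qed
  have c2: "c2 \<in> GF p"
  proof -
    have w': "w ^ p = w" using w by (simp add: GF_def)
    \<comment> \<open>\<open>Z\<close> and \<open>Z'\<close> have the same Lang image. Splitting off
      \<open>(0, c2)\<close>, the only part not yet known to be rational over \<open>GF p\<close>,
      leaves \<open>c2 ^ p + c2 = 0\<close>.\<close>
    have "lang p (witt_add Z (w, c2 + v)) = lang p (witt_add (witt_add Z (w, v)) (0, c2))"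
      by (simp add: witt_add_def add_ac)
    also have "snd \<dots> = snd (lang p (witt_add Z (w, v))) + (c2 ^ p + c2)"
      by (cases Z) (simp add: witt_add_def lang_eq frob_add_1 add_ac)
    also have "lang p (witt_add Z (w, v)) = lang p Z"
      by (rule lang_witt_add) (use w v in simp)
    finally have "c2 ^ p + c2 = 0" using s by (simp flip: Zc)
    then show ?thesis by (simp add: GF_def flip: eq_iff)
  qed
  have carr: "(w, c2) \<in> carrier (witt2 (GF p))" "(0, v) \<in> carrier (witt2 (GF p))"
    using w c2 v by (simp_all add: witt2_def Fp.zero)
  have "\<xi>W (w, c2 + v) = \<xi>W ((w, c2) \<otimes>\<^bsub>witt2 (GF p)\<^esub> (0, v))"
    by (simp add: witt2_def witt_add_def)
  also have "\<dots> = \<xi>W (w, c2) * \<psi> v"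
    by (simp add: dual_mult[OF \<xi>W carr] xi_W_psi[OF v])
  also have "\<psi> v = \<xi>U (r d)" using \<beta>(2)[OF \<tau>] by (simp add: v_def d_def)
  also have "\<xi>W (w, c2) * \<xi>U (r d) = \<xi> (d, b)" using \<xi>_eq[OF g] by (simp add: c2_def w_def)
  finally have "\<xi> (d, b) = \<xi>W (w, c2 + v)" by simp
  moreover have "P' = heis_act p e a P (d, b)" by (simp add: P1(1) P2(1) heis_act_def x' y')
  moreover have "(w, c2 + v) \<in> carrier (witt2 (GF p))"
    using w c2 v by (simp add: witt2_def Fp.add)
  ultimately show ?thesis using g Zc by blast
qed

end

section \<open>The isomorphism of sheaves\<close>

theorem proposition5p4:
  fixes m n p q e :: nat
    and a :: "nat \<Rightarrow> 'k::alg_closed_field"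
    and A :: "('k \<times> 'k) set"
    and Abar U :: "'k set"
    and fU \<Delta> FA ax :: "'k poly"
    and s0 \<alpha> \<beta> :: 'k
    and r :: "'k \<Rightarrow> 'k"
    and \<psi> :: "'k \<Rightarrow> 'l::prime_card Qlbar"
    and \<xi> \<xi>W :: "'k \<times> 'k \<Rightarrow> 'l Qlbar"
    and \<xi>U :: "'k \<Rightarrow> 'l Qlbar"
  assumes "odd CARD('l)"
    and "m \<ge> 1" and "p = 2 ^ m" and "n \<ge> 1" and "q = p ^ n"
    and "CHAR('k) = 2" and "algebraic_over (GF q :: 'k set)"
    and "e \<ge> 1" and "\<forall>i\<le>e. a i \<in> GF q" and "a e \<noteq> 0"
    and "maximal_abelian_subgroup A (heis p e a)" and "A \<subseteq> GF q \<times> GF q"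
    and "Abar = fst ` A" and "U = {x \<in> Abar. f_fun p e a x x = 0}"
    and "fU \<in> linearized p q" and "rsquarefree fU" and "U = Ker fU"
    and "FA = fU ^ p + fU" and "Abar = Ker FA"
    and "s0 \<in> GF q"
    and "\<Delta> \<in> poly_over (GF q)" and "poly \<Delta> 0 = 0"
    and "\<Delta> ^ p + \<Delta> =
      [:0, 1:] * lin_poly p e a + fU * pcompose (Polynomial.monom 1 p + [:0, s0:]) fU"
    and "\<alpha> \<in> GF q" and "proot p \<alpha> + \<alpha> = s0 + 1"
    and "r ` Abar \<subseteq> U" and "\<forall>x\<in>Abar. \<forall>y\<in>Abar. r (x + y) = r x + r y"
    and "\<forall>c\<in>GF p. \<forall>x\<in>Abar. r (c * x) = c * r x" and "\<forall>x\<in>U. r x = x"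
    and "\<psi> \<in> dual (add_group_on (GF p))" and "\<exists>c\<in>GF p. \<psi> c \<noteq> 1"
    and "\<xi> \<in> dual ((heis p e a)\<lparr>carrier := A\<rparr>)" and "\<forall>c\<in>GF p. \<xi> (0, c) = \<psi> c"
    and "\<xi>W \<in> dual (witt2 (GF p))" and "\<xi>U \<in> dual (add_group_on U)"
    and "\<forall>(x, y)\<in>A.
      \<xi> (x, y) = \<xi>W (poly fU x, y + poly \<Delta> x + proot p \<alpha> * poly fU x ^ 2) * \<xi>U (r x)"
    and "ax \<in> linearized p q"
    and "Polynomial.monom 1 q + [:0, 1:] = pcompose ax FA"
    and "Polynomial.monom 1 q + [:0, 1:] = pcompose FA ax"
    and "\<beta> \<in> GF q" and "\<forall>x\<in>GF q. \<xi>U (r (poly ax x)) = \<psi> (ftrace p n (\<beta> * x))"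
  shows "sheaf_iso (GF q) (Q_sheaf q p e a A FA \<xi>) (L_sheaf q p \<xi>W [:0, 1:] [:0, \<beta>, \<alpha>:])"
proof -
  have q: "q = p ^ n" by fact
  interpret heis_data m p "TYPE('k)" e a n A fU \<Delta> ax s0 \<alpha> \<beta> r \<psi> \<xi> \<xi>W \<xi>U U
  proof unfold_locales
    have "CHAR('k) = 2" "m \<ge> 1" "p = 2 ^ m" by fact+
    then interpret char_2_closed m p "TYPE('k)" by unfold_locales
    have "poly fU 0 = 0"
      using \<open>fU \<in> linearized p q\<close> by (rule linearized_zero)
    then show "0 \<in> U" using \<open>U = Ker fU\<close> by (simp add: Ker_def)
  qed (use assms in auto)
  have sep_ax: "Polynomial.degree ax > 0" "poly (pderiv ax) t \<noteq> 0" for t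
    using separable_of_pcompose[OF ax(2)] n by auto
  define fa where "fa = pcompose fU ax"
  \<comment> \<open>\<open>FA\<close> is \<open>X ^ p + X\<close> composed with \<open>fU\<close>,
    so \<open>separable_of_pcompose\<close> applies to \<open>fa\<close> as it does to
    \<open>ax\<close>.\<close>
  have "Polynomial.monom 1 (p ^ n) + [:0, 1:] = pcompose (Polynomial.monom 1 p + [:0, 1:]) fa"
  proof -
    have "pcompose (Polynomial.monom 1 i) Q = Q ^ i" for i and Q :: "'k poly"
      by (induction i) (simp_all add: monom_Suc pcompose_pCons pcompose_1)
    then have "fU ^ p + fU = pcompose (Polynomial.monom 1 p + [:0, 1:]) fU"
      by (simp add: pcompose_add pcompose_pCons)
    then show ?thesis unfolding ax(2) fa_def pcompose_assoc by simp
  qed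
  then have sep_fa: "Polynomial.degree fa > 0" "poly (pderiv fa) t \<noteq> 0" for t
    using separable_of_pcompose n by auto
  have fa_over: "fa \<in> poly_over (GF (p ^ n))"
    unfolding fa_def by (intro Fq.poly_over_pcompose linearized_poly_over fU ax(1))
  have kappa: "(poly [:0, 1:] s, poly [:0, \<beta>, \<alpha>:] s) = (s, \<alpha> * s ^ 2 + \<beta> * s)" for s
    by (simp add: power2_eq_square algebra_simps)
  have rel_fib: "P \<in> C_curve p e a \<and> poly FA (fst P) = s \<longleftrightarrow>
      lang p Z = (poly [:0, 1:] s, poly [:0, \<beta>, \<alpha>:] s)" if "rel P Z" for P Z s
    unfolding kappa \<open>FA = fU ^ p + fU\<close> by (rule rel_lang_iff[OF that])
  have move: "\<exists>g\<in>A. \<exists>c\<in>carrier (witt2 (GF p)).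
      P' = heis_act p e a P g \<and> Z' = witt_add Z c \<and> \<xi> g = \<xi>W c"
    if "P \<in> C_curve p e a" "P' \<in> C_curve p e a"
      "lang p Z = (poly [:0, 1:] s, poly [:0, \<beta>, \<alpha>:] s)"
      "lang p Z' = (poly [:0, 1:] s, poly [:0, \<beta>, \<alpha>:] s)" "rel P Z" "rel P' Z'"
    for P P' Z Z' s
    by (rule rel_move[OF that])
  show ?thesis
    unfolding Q_sheaf_def L_sheaf_def
  proof (rule assoc_sheaf_isoI[where rel = rel and b = fa and F = to_curve
        and b' = ax and F' = to_lang])
    \<comment> \<open>From curve to torsor: a torsor point \<open>Z\<close> is lifted through a root
      \<open>t\<close> of \<open>poly fa t = fst Z\<close>.\<close>
    show "covering_transport (GF q) (C_curve p e a) (\<lambda>P. poly FA (fst P)) A (heis_act p e a) \<xi>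
      (\<lambda>s. s) UNIV (lang p) (carrier (witt2 (GF p))) witt_add \<xi>W
      (\<lambda>s. (poly [:0, 1:] s, poly [:0, \<beta>, \<alpha>:] s)) rel fa to_curve"
      unfolding q
    proof (rule covering_transport.intro)
      show "subfield_of (GF (p ^ n) :: 'k set)" by (rule GF_subfield)
    next
      fix Z :: "'k \<times> 'k" and s t
      assume Z: "lang p Z = (poly [:0, 1:] s, poly [:0, \<beta>, \<alpha>:] s)" and t: "poly fa t = fst Z"
      have r: "rel (to_curve (t, snd Z)) Z"
        using t by (auto simp: rel_def to_curve_def fa_def poly_pcompose char2 prod_eq_iff intro!: exI[of _ t])
      then show "to_curve (t, snd Z) \<in> C_curve p e a \<and> poly FA (fst (to_curve (t, snd Z))) = s
          \<and> rel (to_curve (t, snd Z)) Z"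
        using rel_fib[OF r] Z by blast
    next
      fix Z c c' assume "witt_add Z c = witt_add Z (c' :: 'k \<times> 'k)"
      then show "c = c'" by (auto simp: witt_add_def prod_eq_iff)
    next
      fix Z :: "'k \<times> 'k"
      have "(0, 0) \<in> carrier (witt2 (GF p :: 'k set))" by (simp add: witt2_def Fp.zero)
      moreover have "witt_add Z (0, 0) = Z" by (simp add: witt_add_def)
      moreover have "\<xi>W (0, 0) = 1"
        by (rule dual_idempotent[OF \<xi>W]) (simp_all add: witt2_def witt_add_def Fp.zero)
      ultimately show "\<exists>c\<in>carrier (witt2 (GF p)). witt_add Z c = Z \<and> \<xi>W c = 1" by blast
    next
      fix Z c assume "c \<in> carrier (witt2 (GF p :: 'k set))"
      then show "witt_add Z c \<in> UNIV \<and> lang p (witt_add Z c) = lang p Z"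
        by (simp add: lang_witt_add witt2_def)
    qed (fact sep_fa fa_over polyfun2_to_curve | (rule move; assumption))+
    \<comment> \<open>In the reverse direction a curve point \<open>P\<close> is lifted through a
      root \<open>t\<close> of \<open>poly ax t = fst P\<close>.\<close>
    show "covering_transport (GF q) UNIV (lang p) (carrier (witt2 (GF p))) witt_add \<xi>W
      (\<lambda>s. (poly [:0, 1:] s, poly [:0, \<beta>, \<alpha>:] s))
      (C_curve p e a) (\<lambda>P. poly FA (fst P)) A (heis_act p e a) \<xi> (\<lambda>s. s)
      (\<lambda>Z P. rel P Z) ax to_lang"
      unfolding q
    proof (rule covering_transport.intro)
      show "subfield_of (GF (p ^ n) :: 'k set)" by (rule GF_subfield)
      show "ax \<in> poly_over (GF (p ^ n))" by (rule linearized_poly_over[OF ax(1)])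
    next
      fix P :: "'k \<times> 'k" and s t
      assume P: "P \<in> C_curve p e a" "poly FA (fst P) = s" and t: "poly ax t = fst P"
      have r: "rel P (to_lang (t, snd P))"
        using t by (auto simp: rel_def to_lang_def intro!: exI[of _ t])
      then show "to_lang (t, snd P) \<in> UNIV \<and>
          lang p (to_lang (t, snd P)) = (poly [:0, 1:] s, poly [:0, \<beta>, \<alpha>:] s)
          \<and> rel P (to_lang (t, snd P))"
        using rel_fib[OF r] P by blast
    next
      fix P P' Z Z' s
      assume "P \<in> C_curve p e a" "P' \<in> C_curve p e a"
        "lang p Z = (poly [:0, 1:] s, poly [:0, \<beta>, \<alpha>:] s)"
        "lang p Z' = (poly [:0, 1:] s, poly [:0, \<beta>, \<alpha>:] s)" "rel P Z" "rel P' Z'"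
      from move[OF this] show "\<exists>c\<in>carrier (witt2 (GF p)). \<exists>g\<in>A.
          Z' = witt_add Z c \<and> P' = heis_act p e a P g \<and> \<xi>W c = \<xi> g"
        by metis
    next
      fix P g g' assume "heis_act p e a P g = heis_act p e a P (g' :: 'k \<times> 'k)"
      then show "g = g'" by (auto simp: heis_act_def prod_eq_iff)
    next
      fix P :: "'k \<times> 'k"
      have "(0, 0) \<in> A" using subgroup.one_closed[OF A_subgroup] by (simp add: one_eq)
      moreover have "heis_act p e a P (0, 0) = P" by (simp add: heis_act_def f_zero)
      \<comment> \<open>The neutral element is central, so \<open>\<xi>\<close> takes there the
        value of \<open>\<psi>\<close> at 0.\<close>
      moreover have "\<psi> 0 = 1"
        by (rule dual_idempotent[OF \<psi>]) (simp_all add: add_group_on_def Fp.zero)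
      then have "\<xi> (0, 0) = 1" using \<xi>(2)[OF Fp.zero] by simp
      ultimately show "\<exists>g\<in>A. heis_act p e a P g = P \<and> \<xi> g = 1" by blast
    next
      fix P g assume P: "P \<in> C_curve p e a" and g: "g \<in> A"
      have "poly fU (fst g) ^ p + poly fU (fst g) = 0" using g in_fst_A by blast
      then have "poly FA (fst P + fst g) = poly FA (fst P)"
        unfolding \<open>FA = fU ^ p + fU\<close> by (simp add: fU_add frob_add_1 add_ac)
      then show "heis_act p e a P g \<in> C_curve p e a \<and>
          poly FA (fst (heis_act p e a P g)) = poly FA (fst P)"
        using act_curve[OF P A_carrier[OF g]] by (simp add: heis_act_def)
    qed (fact sep_ax polyfun2_to_lang)+
  qed
qed

end
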